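(* Let $q\in\mathbb{C}$ with $|q|<1$, and let $a,b,c,d,u,v,\alpha,\beta$ be complex numbers. If there are no zero factors in the denominator of the integral, then $$\int_u^v\frac{(qx/u,qx/v,\alpha ax,\beta bx;q)_\infty}{(ax,bx,cx,dx;q)_\infty}\,d_qx$$ $$=\frac{(1-q)v\,(q,u/v,qv/u,cduv;q)_\infty}{(cu,cv,du,dv;q)_\infty}\sum_{n=0}^\infty\frac{\Phi_n^{(\alpha,\beta)}(a,b|q)}{(q;q)_n}\sum_{j=0}^n{n\brack j}_q\frac{(cv,dv;q)_j}{(cduv;q)_j}u^jv^{n-j}.$$
   Context: For $a\in\mathbb{C}$: $(a;q)_0=1$, $(a;q)_n=\prod_{i=0}^{n-1}(1-aq^i)$, $(a;q)_\infty=\prod_{i=0}^\infty(1-aq^i)$, and $(a_1,\ldots,a_m;q)_n=(a_1;q)_n\cdots(a_m;q)_n$ for $n$ a nonnegative integer or $\infty$. The $q$-binomial coefficient is ${n\brack k}_q=\frac{(q;q)_n}{(q;q)_k(q;q)_{n-k}}$, and $\Phi_n^{(\alpha,\beta)}(x,y|q)=\sum_{k=0}^n {n\brack k}_q(\alpha;q)_k(\beta;q)_{n-k}x^ky^{n-k}$. The Jackson $q$-integral is $\int_a^b f(x)\,d_qx=(1-q)\sum_{n=0}^\infty[bf(bq^n)-af(aq^n)]q^n$.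
   Formalization: The identity is asserted when u, v are nonzero, no factor 1-cduv q^k vanishes, and the series over n converges (shown when |au|,|av|,|bu|,|bv|<1); as printed, the right-hand side can diverge or divide by zero. *)

theory Defs
  imports "HOL-Analysis.Analysis"
begin

definition qpoch :: "complex \<Rightarrow> complex \<Rightarrow> nat \<Rightarrow> complex" where
  "qpoch a q n = (\<Prod>i<n. 1 - a * q ^ i)"

text \<open>
  The product converges for \<open>norm q < 1\<close>; as \<open>prodinf\<close> admits finitely many zero factors,
  it is \<open>0\<close> as soon as one factor vanishes.
\<close>

definition qpoch_inf :: "complex \<Rightarrow> complex \<Rightarrow> complex" where
  "qpoch_inf a q = (\<Prod>i. 1 - a * q ^ i)"

definition qpochs :: "complex list \<Rightarrow> complex \<Rightarrow> nat \<Rightarrow> complex" where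
  "qpochs as q n = (\<Prod>a\<leftarrow>as. qpoch a q n)"

definition qpochs_inf :: "complex list \<Rightarrow> complex \<Rightarrow> complex" where
  "qpochs_inf as q = (\<Prod>a\<leftarrow>as. qpoch_inf a q)"

text \<open>Only meaningful for \<open>k \<le> n\<close>, because of the truncated subtraction.\<close>

definition qbinom :: "nat \<Rightarrow> nat \<Rightarrow> complex \<Rightarrow> complex" where
  "qbinom n k q = qpoch q q n / (qpoch q q k * qpoch q q (n - k))"

definition Phi :: "nat \<Rightarrow> complex \<Rightarrow> complex \<Rightarrow> complex \<Rightarrow> complex \<Rightarrow> complex \<Rightarrow> complex" where
  "Phi n \<alpha> \<beta> x y q =
     (\<Sum>k\<le>n. qbinom n k q * qpoch \<alpha> q k * qpoch \<beta> q (n - k) * x ^ k * y ^ (n - k))"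

definition jackson_integral :: "complex \<Rightarrow> complex \<Rightarrow> complex \<Rightarrow> (complex \<Rightarrow> complex) \<Rightarrow> complex" where
  "jackson_integral q a b f =
     (1 - q) * (\<Sum>n. (b * f (b * q ^ n) - a * f (a * q ^ n)) * q ^ n)"

end

theory Submission
  imports Defs "HOL-Complex_Analysis.Complex_Analysis"
begin

text \<open>
  The integrand is a product \<open>w(x) h(x)\<close>, where \<open>w(x) = (q x/u, q x/v; q)\<^sub>\<infinity> / (c x, d x; q)\<^sub>\<infinity>\<close> is the weight of
  the Andrews--Askey integral and \<open>h(x) = (\<alpha> a x, \<beta> b x; q)\<^sub>\<infinity> / (a x, b x; q)\<^sub>\<infinity>\<close>. The \<open>q\<close>-binomial theorem
  shows that \<open>h\<close> is the generating function \<open>\<Sum> \<Phi>\<^sub>n(a, b) x\<^sup>n / (q; q)\<^sub>n\<close>, so that term-by-term integration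
  reduces the claim to the moments of \<open>w\<close>.

  The moments come from \<open>q\<close>-integration by parts: the \<open>q\<close>-derivative of a function vanishing at both
  endpoints has integral 0 (\<open>jackson_integral_q_derivative_eq_0\<close>). Applied to \<open>w\<close> times a polynomial this yields a
  recurrence, which is of first order for the Cauchy polynomials \<open>P\<^sub>j(x) = (x - v)\<dots>(x - q\<^sup>j\<^sup>-\<^sup>1 v)\<close>
  (\<open>qbeta_cauchy_moment_Suc\<close>). Expanding \<open>x\<^sup>n\<close> in the \<open>P\<^sub>j\<close> by the \<open>q\<close>-Pascal rule produces the
  inner sum of the theorem as the ratio of the \<open>n\<close>-th moment to the total mass (\<open>qbeta_moment\<close>).

  The total mass (\<open>andrews_askey_integral\<close>) follows from the same recurrence, which says how the mass
  changes under \<open>c \<mapsto> c q\<close>. Iterating towards \<open>c = 0\<close> and \<open>d = 0\<close> expresses it through the mass of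
  the weight without parameters, and that one is found by going back to \<open>c = q/u\<close>, \<open>d = q/v\<close>, where the weight is
  constant on the lattice.

  Term-by-term integration is justified when all of \<open>|a u|, |a v|, |b u|, |b v|\<close> are below 1
  (\<open>integral_Phi_quotient_eq_series_small\<close>); crude growth bounds for \<open>\<Phi>\<^sub>n\<close> and for the moment ratio
  give the convergence of the series there (\<open>summable_Phi_moment\<close>). If the series merely converges, possibly outside
  that region, \<open>a\<close> and \<open>b\<close> are replaced by \<open>t a\<close> and \<open>t b\<close>, which multiplies the \<open>n\<close>-th term by \<open>t\<^sup>n\<close>. The
  identity then holds for small \<open>t\<close>, by analytic continuation for \<open>|t| < 1\<close>, and at \<open>t = 1\<close>
  by Abel's limit theorem (\<open>integral_Phi_quotient_eq_series\<close>).
\<close>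

section \<open>\<open>q\<close>-shifted factorials\<close>

lemma qpoch_0 [simp]: "qpoch a q 0 = 1"
  by (simp add: qpoch_def)

lemma qpoch_zero [simp]: "qpoch 0 q n = 1"
  by (simp add: qpoch_def)

lemma qpoch_Suc: "qpoch a q (Suc n) = qpoch a q n * (1 - a * q ^ n)"
  by (simp add: qpoch_def)

lemma qpoch_add: "qpoch a q (n + m) = qpoch a q n * qpoch (a * q ^ n) q m"
  by (induction m) (simp_all add: qpoch_Suc power_add mult_ac)

lemma qpoch_inf_zero [simp]: "qpoch_inf 0 q = 1"
  by (simp add: qpoch_inf_def)

context
  fixes q :: complex
  assumes q: "norm q < 1"
begin

lemma norm_q_pow_le_1: "norm q ^ n \<le> 1"
  using q by (simp add: power_le_one)

lemma summable_norm_q_pow: "summable (\<lambda>i. C * norm q ^ i)"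
  using q by (intro summable_mult summable_geometric) auto

lemma q_pow_tendsto_0: "(\<lambda>n. x * q ^ n) \<longlonglongrightarrow> 0"
  using LIMSEQ_power_zero[OF q] tendsto_mult_right_zero by blast

lemma convergent_prod_qpoch: "convergent_prod (\<lambda>i. 1 - a * q ^ i)"
proof -
  have "abs_convergent_prod (\<lambda>i. 1 - a * q ^ i)"
    unfolding abs_convergent_prod_conv_summable
    using summable_norm_q_pow[of "norm a"] by (simp add: norm_mult norm_power)
  thus ?thesis by (rule abs_convergent_prod_imp_convergent_prod)
qed

lemma qpoch_tendsto_qpoch_inf: "(\<lambda>n. qpoch a q n) \<longlonglongrightarrow> qpoch_inf a q"
  using convergent_prod_LIMSEQ[OF convergent_prod_qpoch[of a]]
  unfolding qpoch_def qpoch_inf_def by (simp add: LIMSEQ_lessThan_iff_atMost)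

lemma qpoch_inf_split: "qpoch_inf a q = qpoch a q n * qpoch_inf (a * q ^ n) q"
proof (rule LIMSEQ_unique)
  show "(\<lambda>m. qpoch a q (n + m)) \<longlonglongrightarrow> qpoch_inf a q"
    using LIMSEQ_ignore_initial_segment[OF qpoch_tendsto_qpoch_inf, of a n]
    by (simp add: add.commute)
  show "(\<lambda>m. qpoch a q (n + m)) \<longlonglongrightarrow> qpoch a q n * qpoch_inf (a * q ^ n) q"
    unfolding qpoch_add by (intro tendsto_intros qpoch_tendsto_qpoch_inf)
qed

lemma qpoch_inf_step: "qpoch_inf a q = (1 - a) * qpoch_inf (a * q) q"
  using qpoch_inf_split[of a 1] by (simp add: qpoch_def)

lemma qpoch_inf_eq_0_iff: "qpoch_inf a q = 0 \<longleftrightarrow> (\<exists>k. 1 - a * q ^ k = 0)"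
proof
  assume "qpoch_inf a q = 0"
  thus "\<exists>k. 1 - a * q ^ k = 0"
    using prodinf_nonzero[OF convergent_prod_qpoch[of a]] unfolding qpoch_inf_def by blast
next
  assume "\<exists>k. 1 - a * q ^ k = 0"
  then obtain k where k: "1 - a * q ^ k = 0" ..
  hence "qpoch a q (Suc k) = 0" by (simp add: qpoch_Suc)
  thus "qpoch_inf a q = 0" using qpoch_inf_split[of a "Suc k"] by simp
qed

lemma qpoch_inf_nonzero_if_norm_less_1:
  assumes "norm a < 1"
  shows "qpoch_inf a q \<noteq> 0"
proof
  assume "qpoch_inf a q = 0"
  then obtain k where "a * q ^ k = 1" by (auto simp: qpoch_inf_eq_0_iff)
  hence "norm a * norm q ^ k = 1" by (metis norm_mult norm_one norm_power)
  moreover have "norm a * norm q ^ k \<le> norm a"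
    using norm_q_pow_le_1[of k] by (simp add: mult_left_le)
  ultimately show False using assms by simp
qed

lemma qpoch_inf_q_pow_nonzero:
  "qpoch_inf a q \<noteq> 0 \<Longrightarrow> qpoch_inf (a * q ^ n) q \<noteq> 0"
  using qpoch_inf_split[of a n] by auto

lemma qpoch_nonzero: "qpoch_inf a q \<noteq> 0 \<Longrightarrow> qpoch a q n \<noteq> 0"
  using qpoch_inf_split[of a n] by auto

lemma qpoch_q_nonzero: "qpoch q q n \<noteq> 0"
  by (intro qpoch_nonzero qpoch_inf_nonzero_if_norm_less_1 q)

text \<open>
  The bound \<open>\<Prod>(1 + |a| |q|\<^sup>i) \<le> exp (\<Sum> |a| |q|\<^sup>i)\<close> is uniform in the length of the product and in \<open>a\<close>
  from a bounded set, which is what the majorant of the continuation argument needs.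
\<close>
lemma norm_qpoch_le: "norm (qpoch a q n) \<le> exp (norm a / (1 - norm q))"
proof -
  have "norm (qpoch a q n) = (\<Prod>i<n. norm (1 - a * q ^ i))"
    by (simp add: qpoch_def prod_norm)
  also have "\<dots> \<le> (\<Prod>i<n. 1 + norm a * norm q ^ i)"
  proof (rule prod_mono)
    fix i
    show "0 \<le> norm (1 - a * q ^ i) \<and> norm (1 - a * q ^ i) \<le> 1 + norm a * norm q ^ i"
      using norm_triangle_ineq4[of 1 "a * q ^ i"] by (simp add: norm_mult norm_power)
  qed
  also have "\<dots> \<le> exp (\<Sum>i<n. norm a * norm q ^ i)"
    by (rule prod_le_exp_sum) auto
  also have "(\<Sum>i<n. norm a * norm q ^ i) \<le> (\<Sum>i. norm a * norm q ^ i)"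
    by (rule sum_le_suminf) (use summable_norm_q_pow in auto)
  also have "\<dots> = norm a / (1 - norm q)"
    using q by (subst suminf_mult) (auto simp: suminf_geometric summable_geometric)
  finally show ?thesis by simp
qed

lemma norm_qpoch_inf_le: "norm (qpoch_inf a q) \<le> exp (norm a / (1 - norm q))"
  by (rule LIMSEQ_le_const2[OF tendsto_norm[OF qpoch_tendsto_qpoch_inf]])
     (use norm_qpoch_le in blast)

lemma holomorphic_qpoch_inf: "(\<lambda>a. qpoch_inf a q) holomorphic_on UNIV"
proof (rule holomorphic_uniform_sequence[where f = "\<lambda>n a. qpoch a q n"])
  show "(\<lambda>a. qpoch a q n) holomorphic_on UNIV" for n
    unfolding qpoch_def by (intro holomorphic_intros)
next
  fix x :: complex
  let ?K = "cball x 1"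
  have "uniformly_convergent_on ?K (\<lambda>N a. \<Prod>i<N. 1 - a * q ^ i)"
  proof (rule uniformly_convergent_on_prod')
    show "uniformly_convergent_on ?K (\<lambda>N a. \<Sum>i<N. norm (1 - a * q ^ i - 1))"
    proof (rule Weierstrass_m_test')
      fix n a assume "a \<in> ?K"
      hence "norm (a - x) \<le> 1" by (simp add: dist_norm norm_minus_commute)
      hence "norm a \<le> norm x + 1"
        using norm_triangle_ineq2[of a x] by simp
      thus "norm (norm (1 - a * q ^ n - 1)) \<le> (norm x + 1) * norm q ^ n"
        by (auto simp: norm_mult norm_power intro!: mult_right_mono)
    qed (rule summable_norm_q_pow)
  qed (auto intro!: continuous_intros)
  then obtain l where l: "uniform_limit ?K (\<lambda>N a. qpoch a q N) l sequentially"
    unfolding uniformly_convergent_on_def qpoch_def by blast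
  have "l a = qpoch_inf a q" if "a \<in> ?K" for a
    using tendsto_uniform_limitI[OF l that] qpoch_tendsto_qpoch_inf LIMSEQ_unique by blast
  hence "uniform_limit ?K (\<lambda>N a. qpoch a q N) (\<lambda>a. qpoch_inf a q) sequentially"
    using l by (subst uniform_limit_cong'[where g = "\<lambda>N a. qpoch a q N" and i = l]) auto
  thus "\<exists>d>0. cball x d \<subseteq> UNIV \<and>
          uniform_limit (cball x d) (\<lambda>n a. qpoch a q n) (\<lambda>a. qpoch_inf a q) sequentially"
    by (intro exI[of _ 1]) auto
qed auto

lemma holomorphic_qpoch_inf_compose:
  "f holomorphic_on A \<Longrightarrow> (\<lambda>z. qpoch_inf (f z) q) holomorphic_on A"
  using holomorphic_on_compose_gen[OF _ holomorphic_qpoch_inf, of f A] by (simp add: o_def)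

lemma isCont_qpoch_inf:
  "isCont f z \<Longrightarrow> isCont (\<lambda>z. qpoch_inf (f z) q) z"
proof -
  assume f: "isCont f z"
  have "isCont (\<lambda>a. qpoch_inf a q) (f z)"
    using holomorphic_on_imp_continuous_on[OF holomorphic_qpoch_inf]
    by (simp add: continuous_on_eq_continuous_at)
  thus ?thesis by (rule isCont_o2[OF f])
qed

lemma isCont_qpoch_inf_linear: "isCont (\<lambda>x. qpoch_inf (k * x) q) z"
  by (intro isCont_qpoch_inf isCont_mult continuous_const continuous_ident)

lemma qpoch_ratio_bounded:
  assumes "qpoch_inf b q \<noteq> 0"
  obtains C where "C > 0" "\<And>n. norm (qpoch a q n / qpoch b q n) \<le> C"
proof -
  have "(\<lambda>n. qpoch a q n / qpoch b q n) \<longlonglongrightarrow> qpoch_inf a q / qpoch_inf b q"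
    by (intro tendsto_intros qpoch_tendsto_qpoch_inf assms)
  hence "Bseq (\<lambda>n. qpoch a q n / qpoch b q n)"
    using convergentI convergent_imp_Bseq by blast
  thus ?thesis using that by (auto simp: Bseq_def)
qed

end

section \<open>The \<open>q\<close>-binomial theorem\<close>

context
  fixes q :: complex
  assumes q: "norm q < 1"
begin

text \<open>
  Both sides satisfy the equation \<open>(1 - y) f(y) = (1 - \<alpha> y) f(q y)\<close>, are continuous at the
  origin and take the value 1 there, which determines \<open>f\<close> by iteration.
\<close>
theorem q_binomial_theorem:
  assumes y: "norm y < 1"
  shows "summable (\<lambda>k. norm (qpoch \<alpha> q k / qpoch q q k * y ^ k))"
    and "(\<lambda>k. qpoch \<alpha> q k / qpoch q q k * y ^ k) sums (qpoch_inf (\<alpha> * y) q / qpoch_inf y q)"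
proof -
  define c where "c = (\<lambda>k. qpoch \<alpha> q k / qpoch q q k)"
  define f where "f = (\<lambda>y. \<Sum>k. c k * y ^ k)"
  obtain C where C: "C > 0" "\<And>n. norm (c n) \<le> C"
    using qpoch_ratio_bounded[OF q, of q \<alpha>] qpoch_inf_nonzero_if_norm_less_1[OF q q] 
    unfolding c_def by blast
  have ns: "summable (\<lambda>k. norm (c k * z ^ k))" if z: "norm z < 1" for z
  proof (rule summable_comparison_test)
    show "\<exists>N. \<forall>n\<ge>N. norm (norm (c n * z ^ n)) \<le> C * norm z ^ n"
      using C by (auto simp: norm_mult norm_power intro!: mult_right_mono)
    show "summable (\<lambda>n. C * norm z ^ n)"
      using z by (intro summable_mult summable_geometric) auto
  qed
  have fsums: "(\<lambda>k. c k * z ^ k) sums f z" if "norm z < 1" for z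
    unfolding f_def using summable_norm_cancel[OF ns[OF that]] by (rule summable_sums)
  \<comment> \<open>Compare coefficients: \<open>f(z) - f(q z)\<close> has coefficients \<open>c\<^sub>k (1 - q\<^sup>k)\<close>.\<close>
  have f_eq: "(1 - z) * f z = (1 - \<alpha> * z) * f (q * z)" if z: "norm z < 1" for z
  proof -
    have qz: "norm (q * z) < 1"
      using z q by (metis norm_mult mult_strict_mono' norm_ge_zero mult_1_left)
    have "(\<lambda>k. c k * z ^ k - c k * (q * z) ^ k) sums (f z - f (q * z))"
      by (intro sums_diff fsums z qz)
    moreover have "c 0 * z ^ 0 - c 0 * (q * z) ^ 0 = 0" by simp
    ultimately have L: "(\<lambda>k. c (Suc k) * z ^ Suc k - c (Suc k) * (q * z) ^ Suc k)
        sums (f z - f (q * z))"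
      by (subst sums_Suc_iff) simp
    have "c (Suc k) * z ^ Suc k - c (Suc k) * (q * z) ^ Suc k
        = z * (c k * z ^ k) - \<alpha> * z * (c k * (q * z) ^ k)" for k
    proof -
      have "1 - q * q ^ k \<noteq> 0"
        using qpoch_q_nonzero[OF q, of "Suc k"] by (simp add: qpoch_Suc)
      hence "c (Suc k) * (1 - q ^ Suc k) = c k * (1 - \<alpha> * q ^ k)"
        using qpoch_q_nonzero[OF q, of k] unfolding c_def by (simp add: qpoch_Suc field_simps)
      hence "c (Suc k) * (1 - q ^ Suc k) * z ^ Suc k = c k * (1 - \<alpha> * q ^ k) * z ^ Suc k"
        by simp
      thus ?thesis by (simp add: algebra_simps power_mult_distrib)
    qed
    hence "(\<lambda>k. z * (c k * z ^ k) - \<alpha> * z * (c k * (q * z) ^ k)) sums (f z - f (q * z))"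
      using L by simp
    moreover have "(\<lambda>k. z * (c k * z ^ k) - \<alpha> * z * (c k * (q * z) ^ k))
        sums (z * f z - \<alpha> * z * f (q * z))"
      by (intro sums_diff sums_mult fsums z qz)
    ultimately have "f z - f (q * z) = z * f z - \<alpha> * z * f (q * z)"
      using sums_unique2 by blast
    thus ?thesis by (simp add: algebra_simps)
  qed
  have iter: "qpoch y q n * f y = qpoch (\<alpha> * y) q n * f (y * q ^ n)" for n
  proof (induction n)
    case (Suc n)
    have "norm (y * q ^ n) \<le> norm y"
      using norm_q_pow_le_1[OF q, of n] by (simp add: norm_mult norm_power mult_left_le)
    hence *: "(1 - y * q ^ n) * f (y * q ^ n) = (1 - \<alpha> * (y * q ^ n)) * f (y * q ^ Suc n)"
      using f_eq[of "y * q ^ n"] y by (simp add: mult_ac)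
    have "qpoch y q (Suc n) * f y = (1 - y * q ^ n) * (qpoch y q n * f y)"
      by (simp add: qpoch_Suc)
    also have "\<dots> = qpoch (\<alpha> * y) q n * ((1 - y * q ^ n) * f (y * q ^ n))"
      using Suc.IH by simp
    also have "\<dots> = qpoch (\<alpha> * y) q (Suc n) * f (y * q ^ Suc n)"
      unfolding * by (simp add: qpoch_Suc mult_ac)
    finally show ?case .
  qed simp
  have "isCont f 0"
    unfolding f_def
    by (rule isCont_powser[of _ "1/2"])
       (use summable_norm_cancel[OF ns[of "1/2"]] in \<open>simp_all\<close>)
  hence "(\<lambda>n. f (y * q ^ n)) \<longlonglongrightarrow> f 0"
    by (rule isCont_tendsto_compose) (rule q_pow_tendsto_0[OF q])
  moreover have "f 0 = 1" unfolding f_def powser_zero by (simp add: c_def)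
  ultimately have "(\<lambda>n. qpoch (\<alpha> * y) q n * f (y * q ^ n)) \<longlonglongrightarrow> qpoch_inf (\<alpha> * y) q * 1"
    by (intro tendsto_mult qpoch_tendsto_qpoch_inf[OF q]) simp
  moreover have "(\<lambda>n. qpoch y q n * f y) \<longlonglongrightarrow> qpoch_inf y q * f y"
    by (intro tendsto_intros qpoch_tendsto_qpoch_inf[OF q])
  ultimately have "qpoch_inf y q * f y = qpoch_inf (\<alpha> * y) q"
    using iter LIMSEQ_unique by simp
  hence "f y = qpoch_inf (\<alpha> * y) q / qpoch_inf y q"
    using qpoch_inf_nonzero_if_norm_less_1[OF q y] by (simp add: field_simps)
  with fsums[OF y] show "(\<lambda>k. qpoch \<alpha> q k / qpoch q q k * y ^ k)
      sums (qpoch_inf (\<alpha> * y) q / qpoch_inf y q)" by (simp add: c_def)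
  show "summable (\<lambda>k. norm (qpoch \<alpha> q k / qpoch q q k * y ^ k))"
    using ns[OF y] by (simp add: c_def)
qed

end

section \<open>Jackson integrals as lattice sums\<close>

text \<open>
  A Jackson integral only sees these points, which accumulate at the origin alone. So continuity of
  the integrand at the origin, written \<open>isCont f 0\<close> below, already gives boundedness on all the points
  and hence absolute convergence.
\<close>
definition qlattice :: "complex \<Rightarrow> complex \<Rightarrow> complex \<Rightarrow> complex set" where
  "qlattice q u v = range (\<lambda>n. u * q ^ n) \<union> range (\<lambda>n. v * q ^ n)"

lemma qlatticeE:
  assumes "x \<in> qlattice q u v"
  obtains n where "x = u * q ^ n" | n where "x = v * q ^ n"
  using assms by (auto simp: qlattice_def)

lemma qlattice_memI [simp]: "u * q ^ n \<in> qlattice q u v" "v * q ^ n \<in> qlattice q u v"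
  by (auto simp: qlattice_def)

lemma jackson_integral_cong:
  assumes "\<And>x. x \<in> qlattice q u v \<Longrightarrow> f x = g x"
  shows "jackson_integral q u v f = jackson_integral q u v g"
  unfolding jackson_integral_def using assms by simp

context
  fixes q :: complex
  assumes q: "norm q < 1"
begin

lemma norm_qlattice_le: "x \<in> qlattice q u v \<Longrightarrow> norm x \<le> max (norm u) (norm v)"
  using norm_q_pow_le_1[OF q]
  by (auto elim!: qlatticeE simp: norm_mult norm_power le_max_iff_disj intro!: mult_left_le)

lemma qpoch_inf_nonzero_on_qlattice:
  assumes "qpoch_inf (c * u) q \<noteq> 0" "qpoch_inf (c * v) q \<noteq> 0" "x \<in> qlattice q u v"
  shows "qpoch_inf (c * x) q \<noteq> 0"
  using assms qpoch_inf_q_pow_nonzero[OF q, of "c * u"] qpoch_inf_q_pow_nonzero[OF q, of "c * v"]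
  by (auto elim!: qlatticeE simp: mult.assoc)

lemma isCont_0_bounded_on_qlattice:
  fixes f :: "complex \<Rightarrow> complex"
  assumes "isCont f 0"
  obtains B where "B > 0" "\<And>x. x \<in> qlattice q u v \<Longrightarrow> norm (f x) \<le> B"
proof -
  have "Bseq (\<lambda>n. f (z * q ^ n))" for z
    using isCont_tendsto_compose[OF assms q_pow_tendsto_0[OF q, of z]]
    by (intro convergent_imp_Bseq convergentI)
  then obtain B1 B2 where "B1 > 0" "\<And>n. norm (f (u * q ^ n)) \<le> B1"
      "B2 > 0" "\<And>n. norm (f (v * q ^ n)) \<le> B2"
    unfolding Bseq_def by metis
  hence "max B1 B2 > 0" "\<And>x. x \<in> qlattice q u v \<Longrightarrow> norm (f x) \<le> max B1 B2"
    by (auto elim!: qlatticeE simp: le_max_iff_disj)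
  thus ?thesis using that by blast
qed

lemma norm_jackson_term_le:
  assumes "\<And>x. x \<in> qlattice q u v \<Longrightarrow> norm (f x) \<le> B"
  shows "norm ((v * f (v * q ^ n) - u * f (u * q ^ n)) * q ^ n)
           \<le> (norm v * B + norm u * B) * norm q ^ n"
proof -
  have "norm (v * f (v * q ^ n) - u * f (u * q ^ n))
      \<le> norm v * norm (f (v * q ^ n)) + norm u * norm (f (u * q ^ n))"
    by (rule order_trans[OF norm_triangle_ineq4]) (simp add: norm_mult)
  also have "\<dots> \<le> norm v * B + norm u * B"
    by (intro add_mono mult_left_mono assms) auto
  finally show ?thesis
    by (simp add: norm_mult norm_power mult_right_mono)
qed

lemma jackson_summable:
  assumes "isCont f 0"
  shows "summable (\<lambda>n. (v * f (v * q ^ n) - u * f (u * q ^ n)) * q ^ n)"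
proof -
  obtain B where B: "\<And>x. x \<in> qlattice q u v \<Longrightarrow> norm (f x) \<le> B"
    using isCont_0_bounded_on_qlattice[OF assms] by metis
  show ?thesis
    by (rule summable_comparison_test'[OF summable_norm_q_pow[OF q]])
       (rule norm_jackson_term_le[OF B])
qed

lemma jackson_integral_add:
  assumes "isCont f 0" "isCont g 0"
  shows "jackson_integral q u v (\<lambda>x. f x + g x)
         = jackson_integral q u v f + jackson_integral q u v g"
proof -
  have "(v * (f (v * q ^ n) + g (v * q ^ n)) - u * (f (u * q ^ n) + g (u * q ^ n))) * q ^ n
      = (v * f (v * q ^ n) - u * f (u * q ^ n)) * q ^ n
        + (v * g (v * q ^ n) - u * g (u * q ^ n)) * q ^ n" for n
    by (simp add: algebra_simps)
  thus ?thesis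
    unfolding jackson_integral_def
    by (simp add: suminf_add[symmetric] jackson_summable assms distrib_left)
qed

lemma jackson_integral_cmult:
  assumes "isCont f 0"
  shows "jackson_integral q u v (\<lambda>x. k * f x) = k * jackson_integral q u v f"
proof -
  have "(v * (k * f (v * q ^ n)) - u * (k * f (u * q ^ n))) * q ^ n
      = k * ((v * f (v * q ^ n) - u * f (u * q ^ n)) * q ^ n)" for n
    by (simp add: algebra_simps)
  thus ?thesis
    unfolding jackson_integral_def
    by (simp only: suminf_mult[OF jackson_summable[OF assms]]) (simp only: mult_ac)
qed

lemma jackson_integral_sum:
  assumes "finite I" "\<And>i. i \<in> I \<Longrightarrow> isCont (f i) 0"
  shows "jackson_integral q u v (\<lambda>x. \<Sum>i\<in>I. f i x) = (\<Sum>i\<in>I. jackson_integral q u v (f i))"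
  using assms
proof (induction I rule: finite_induct)
  case empty
  show ?case by (simp add: jackson_integral_def)
next
  case (insert i I)
  thus ?case by (simp add: jackson_integral_add)
qed

lemma jackson_integral_swap:
  assumes "isCont f 0"
  shows "jackson_integral q u v f = - jackson_integral q v u f"
  unfolding jackson_integral_def
  using suminf_minus[OF jackson_summable[OF assms, of u v]]
  by (simp add: algebra_simps)

text \<open>
  The \<open>q\<close>-analogue of the fundamental theorem of calculus for an antiderivative vanishing at
  both endpoints: \<open>f(x) = (g(x) - g(q x)) / x\<close> is, up to a constant, the \<open>q\<close>-derivative of \<open>g\<close>,
  so the sum telescopes.
\<close>
lemma jackson_integral_q_derivative_eq_0:
  assumes g: "isCont g 0" "g u = 0" "g v = 0"
    and fg: "\<And>x. x \<in> qlattice q u v \<Longrightarrow> x * f x = g x - g (q * x)"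
  shows "jackson_integral q u v f = 0"
proof -
  define G where "G = (\<lambda>n. g (v * q ^ n) - g (u * q ^ n))"
  have *: "x * q ^ n * f (x * q ^ n) = g (x * q ^ n) - g (x * q ^ Suc n)" 
    if "x = u \<or> x = v" for x n
    using fg[of "x * q ^ n"] that by (auto simp: mult_ac)
  have "(v * f (v * q ^ n) - u * f (u * q ^ n)) * q ^ n = G n - G (Suc n)" for n
  proof -
    have "(v * f (v * q ^ n) - u * f (u * q ^ n)) * q ^ n
        = v * q ^ n * f (v * q ^ n) - u * q ^ n * f (u * q ^ n)"
      by (simp add: algebra_simps)
    also have "\<dots> = G n - G (Suc n)"
      by (simp only: G_def *[OF disjI1[OF refl]] *[OF disjI2[OF refl]]) (simp add: algebra_simps)
    finally show ?thesis .
  qed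
  moreover have "(\<lambda>n. G n - G (Suc n)) sums (G 0 - (g 0 - g 0))"
    unfolding G_def
    by (intro telescope_sums' tendsto_diff isCont_tendsto_compose[OF g(1)] q_pow_tendsto_0 q)
  ultimately show ?thesis
    using g by (simp add: jackson_integral_def G_def sums_iff)
qed

text \<open>
  Dominated convergence; the geometric factor \<open>q\<^sup>n\<close> turns a uniform bound into the majorant that
  Tannery's theorem asks for.
\<close>
lemma jackson_integral_tendsto:
  assumes lim: "\<And>x. x \<in> qlattice q u v \<Longrightarrow> (\<lambda>N. f N x) \<longlonglongrightarrow> g x"
    and bound: "\<And>N x. x \<in> qlattice q u v \<Longrightarrow> norm (f N x) \<le> B"
  shows "(\<lambda>N. jackson_integral q u v (f N)) \<longlonglongrightarrow> jackson_integral q u v g"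
proof -
  have "(\<lambda>N. \<Sum>n. (v * f N (v * q ^ n) - u * f N (u * q ^ n)) * q ^ n)
      \<longlonglongrightarrow> (\<Sum>n. (v * g (v * q ^ n) - u * g (u * q ^ n)) * q ^ n)"
  proof (rule tannerys_theorem[THEN conjunct2, THEN conjunct2])
    show "(\<lambda>N. (v * f N (v * q ^ n) - u * f N (u * q ^ n)) * q ^ n)
        \<longlonglongrightarrow> (v * g (v * q ^ n) - u * g (u * q ^ n)) * q ^ n" for n
      by (intro tendsto_intros lim) auto
    show "\<forall>\<^sub>F (n, N) in sequentially \<times>\<^sub>F sequentially.
        norm ((v * f N (v * q ^ n) - u * f N (u * q ^ n)) * q ^ n)
          \<le> (norm v * B + norm u * B) * norm q ^ n"
      by (intro always_eventually) (use norm_jackson_term_le[OF bound] in auto)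
    show "summable (\<lambda>n. (norm v * B + norm u * B) * norm q ^ n)"
      by (rule summable_norm_q_pow[OF q])
  qed simp
  thus ?thesis unfolding jackson_integral_def by (intro tendsto_intros)
qed

lemma jackson_integral_const: "jackson_integral q u v (\<lambda>x. 1) = v - u"
proof -
  have "1 - q \<noteq> 0" using q by auto
  moreover have "(\<Sum>n. (v - u) * q ^ n) = (v - u) * (1 / (1 - q))"
    using q by (subst suminf_mult) (auto simp: suminf_geometric summable_geometric)
  ultimately show ?thesis by (simp add: jackson_integral_def)
qed

text \<open>
  If \<open>u\<close> lies on the lattice of \<open>v\<close>, the lattice sum from \<open>u\<close> cancels against a tail of the one
  from \<open>v\<close>, and only the points between the endpoints remain.
\<close>
lemma jackson_integral_eq_0_if_commensurable:
  assumes u: "u = v * q ^ m" and f: "isCont f 0" and f0: "\<And>n. n < m \<Longrightarrow> f (v * q ^ n) = 0"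
  shows "jackson_integral q u v f = 0"
proof -
  define F where "F = (\<lambda>n. v * f (v * q ^ n) * q ^ n)"
  have F: "summable F" using jackson_summable[OF f, of v 0] by (simp add: F_def)
  have "(v * f (v * q ^ n) - u * f (u * q ^ n)) * q ^ n = F n - F (n + m)" for n
    unfolding F_def u by (simp add: algebra_simps power_add)
  moreover have "(\<Sum>n. F n - F (n + m)) = (\<Sum>n. F n) - (\<Sum>n. F (n + m))"
    using F by (intro suminf_diff[symmetric]) (auto simp: summable_iff_shift)
  moreover have "(\<Sum>n. F n) = (\<Sum>n. F (n + m)) + (\<Sum>n<m. F n)"
    by (rule suminf_split_initial_segment[OF F])
  moreover have "(\<Sum>n<m. F n) = 0" by (simp add: F_def f0)
  ultimately show ?thesis by (simp add: jackson_integral_def)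
qed

end

section \<open>Moments of the \<open>q\<close>-beta weight\<close>

definition qbeta_weight :: "complex \<Rightarrow> complex \<Rightarrow> complex \<Rightarrow> complex \<Rightarrow> complex \<Rightarrow> complex \<Rightarrow> complex"
  where "qbeta_weight q u v c d x =
    qpoch_inf (q * x / u) q * qpoch_inf (q * x / v) q / (qpoch_inf (c * x) q * qpoch_inf (d * x) q)"

lemma qbeta_weight_commute: "qbeta_weight q u v c d = qbeta_weight q u v d c"
  by (simp add: qbeta_weight_def fun_eq_iff mult_ac)

text \<open>
  The quotient of the \<open>n\<close>-th moment of the weight by its total mass. It is defined by the explicit sum
  because the total mass can vanish, for instance when \<open>u = v\<close>.
\<close>
definition qbeta_moment_ratio ::
  "complex \<Rightarrow> complex \<Rightarrow> complex \<Rightarrow> complex \<Rightarrow> complex \<Rightarrow> nat \<Rightarrow> complex" where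
  "qbeta_moment_ratio q u v c d n =
     (\<Sum>j\<le>n. qbinom n j q * (qpochs [c * v, d * v] q j / qpoch (c * d * u * v) q j)
        * u ^ j * v ^ (n - j))"

text \<open>
  The basis \<open>P\<^sub>j(x) = (x - v)(x - q v)\<dots>(x - q\<^sup>j\<^sup>-\<^sup>1 v)\<close>. Its moments obey a first-order recurrence, while
  those of the monomials obey one of second order.
\<close>
definition cauchy_poly :: "complex \<Rightarrow> complex \<Rightarrow> nat \<Rightarrow> complex \<Rightarrow> complex" where
  "cauchy_poly q v j x = (\<Prod>i<j. x - v * q ^ i)"

lemma cauchy_poly_0 [simp]: "cauchy_poly q v 0 x = 1"
  by (simp add: cauchy_poly_def)

lemma cauchy_poly_Suc: "cauchy_poly q v (Suc j) x = cauchy_poly q v j x * (x - v * q ^ j)"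
  by (simp add: cauchy_poly_def)

lemma cauchy_poly_Suc_dilate:
  "cauchy_poly q v (Suc j) (q * x) = (q * x - v) * q ^ j * cauchy_poly q v j x"
proof (induction j)
  case (Suc j)
  have "cauchy_poly q v (Suc (Suc j)) (q * x) = cauchy_poly q v (Suc j) (q * x) * (q * x - v * q ^ Suc j)"
    by (rule cauchy_poly_Suc)
  also have "\<dots> = (q * x - v) * q ^ Suc j * cauchy_poly q v (Suc j) x"
    unfolding Suc.IH cauchy_poly_Suc[of q v j x] by (simp add: algebra_simps)
  finally show ?case .
qed (simp add: cauchy_poly_Suc)

lemma cauchy_poly_Suc_self: "cauchy_poly q v (Suc j) v = 0"
  by (induction j) (simp_all add: cauchy_poly_Suc)

lemma isCont_cauchy_poly: "isCont (cauchy_poly q v j) x"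
  unfolding cauchy_poly_def[abs_def] by (intro continuous_intros)

context
  fixes q :: complex
  assumes q: "norm q < 1"
begin

lemma qbinom_0 [simp]: "qbinom n 0 q = 1"
  using qpoch_q_nonzero[OF q] by (simp add: qbinom_def)

lemma qbinom_self [simp]: "qbinom n n q = 1"
  using qpoch_q_nonzero[OF q] by (simp add: qbinom_def)

text \<open>
  The hypothesis \<open>k < n\<close> excludes the index \<open>k = n\<close>, where the truncated subtraction in the definition
  gives \<open>qbinom n (Suc n) q\<close> a spurious non-zero value.
\<close>
lemma qbinom_Suc_Suc:
  assumes "k < n"
  shows "qbinom (Suc n) (Suc k) q = qbinom n k q + q ^ Suc k * qbinom n (Suc k) q"
proof -
  obtain m where m: "n = Suc (k + m)" using assms less_iff_Suc_add by blast
  have ne: "1 - q * q ^ i \<noteq> 0" for i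
    using qpoch_q_nonzero[OF q, of "Suc i"] by (simp add: qpoch_Suc)
  have "n - k = Suc m" "n - Suc k = m" "Suc n - Suc k = Suc m" using m by auto
  thus ?thesis
    unfolding qbinom_def using qpoch_q_nonzero[OF q] ne
    by (simp add: qpoch_Suc m divide_simps) (simp add: algebra_simps power_add)
qed

text \<open>Cauchy's expansion; the induction step is the \<open>q\<close>-Pascal rule.\<close>
lemma power_eq_sum_cauchy_poly:
  "x ^ n = (\<Sum>j\<le>n. qbinom n j q * v ^ (n - j) * cauchy_poly q v j x)"
proof (induction n)
  case (Suc n)
  let ?P = "\<lambda>j. cauchy_poly q v j x"
  define T where "T = (\<lambda>j. qbinom n j q * v ^ (n - j) * ?P (Suc j))"
  \<comment> \<open>Extending \<open>B\<close> by 0 to the index \<open>Suc n\<close> makes the index shift below uniform.\<close>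
  define B where "B = (\<lambda>j. if j \<le> n then qbinom n j q * q ^ j * v ^ (Suc n - j) * ?P j else 0)"
  have "x ^ Suc n = (\<Sum>j\<le>n. qbinom n j q * v ^ (n - j) * ?P j * x)"
    unfolding power_Suc2 Suc.IH sum_distrib_right ..
  also have "\<dots> = (\<Sum>j\<le>n. T j + B j)"
    by (intro sum.cong refl)
       (simp add: T_def B_def cauchy_poly_Suc Suc_diff_le algebra_simps)
  also have "\<dots> = (\<Sum>j\<le>n. T j) + (\<Sum>j\<le>Suc n. B j)"
    by (simp add: sum.distrib B_def)
  also have "\<dots> = B 0 + (\<Sum>j\<le>n. T j + B (Suc j))"
    by (simp only: sum.atMost_Suc_shift sum.distrib) (simp only: add_ac)
  also have "(\<Sum>j\<le>n. T j + B (Suc j))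
      = (\<Sum>j\<le>n. qbinom (Suc n) (Suc j) q * v ^ (Suc n - Suc j) * ?P (Suc j))"
  proof (intro sum.cong refl)
    fix j assume "j \<in> {..n}"
    hence "j < n \<or> j = n" by auto
    thus "T j + B (Suc j) = qbinom (Suc n) (Suc j) q * v ^ (Suc n - Suc j) * ?P (Suc j)"
    proof
      assume "j < n"
      thus ?thesis by (simp add: T_def B_def qbinom_Suc_Suc algebra_simps)
    qed (simp add: T_def B_def)
  qed
  also have "B 0 + \<dots> = (\<Sum>j\<le>Suc n. qbinom (Suc n) j q * v ^ (Suc n - j) * ?P j)"
    by (subst sum.atMost_Suc_shift) (simp add: B_def)
  finally show ?case .
qed simp

lemma isCont_qbeta_weight:
  "isCont (qbeta_weight q u v c d) 0"
proof -
  have "isCont (\<lambda>x. qpoch_inf (q / u * x) q * qpoch_inf (q / v * x) q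
          / (qpoch_inf (c * x) q * qpoch_inf (d * x) q)) 0"
    by (intro isCont_divide isCont_mult isCont_qpoch_inf_linear[OF q]) simp
  thus ?thesis by (simp add: qbeta_weight_def[abs_def])
qed

lemma qbeta_weight_dilate:
  assumes "qpoch_inf (c * x) q \<noteq> 0" "qpoch_inf (d * x) q \<noteq> 0"
  shows "(1 - q * x / u) * (1 - q * x / v) * qbeta_weight q u v c d (q * x)
         = (1 - c * x) * (1 - d * x) * qbeta_weight q u v c d x"
proof -
  have eq: "qpoch_inf (k * x) q = (1 - k * x) * qpoch_inf (k * (q * x)) q"
       "qpoch_inf (q * x / u) q = (1 - q * x / u) * qpoch_inf (q * (q * x) / u) q"
       "qpoch_inf (q * x / v) q = (1 - q * x / v) * qpoch_inf (q * (q * x) / v) q" for k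
    using qpoch_inf_step[OF q, of "k * x"] qpoch_inf_step[OF q, of "q * x / u"]
      qpoch_inf_step[OF q, of "q * x / v"] by (simp_all add: mult_ac)
  have ne: "1 - c * x \<noteq> 0" "1 - d * x \<noteq> 0" "qpoch_inf (c * (q * x)) q \<noteq> 0" "qpoch_inf (d * (q * x)) q \<noteq> 0"
    using assms eq(1)[of c] eq(1)[of d] by auto
  show ?thesis
    unfolding qbeta_weight_def eq(1)[of c] eq(1)[of d] eq(2,3) using ne by simp
qed

lemma qbeta_weight_q_shift:
  assumes "qpoch_inf (c * x) q \<noteq> 0"
  shows "qbeta_weight q u v (c * q) d x = (1 - c * x) * qbeta_weight q u v c d x"
proof -
  have "qpoch_inf (c * x) q = (1 - c * x) * qpoch_inf (c * q * x) q"
    using qpoch_inf_step[OF q, of "c * x"] by (simp add: mult_ac)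
  thus ?thesis using assms by (simp add: qbeta_weight_def)
qed

context
  fixes u v c d :: complex
  assumes uv: "u \<noteq> 0" "v \<noteq> 0"
    and cu: "qpoch_inf (c * u) q \<noteq> 0" and cv: "qpoch_inf (c * v) q \<noteq> 0"
    and du: "qpoch_inf (d * u) q \<noteq> 0" and dv: "qpoch_inf (d * v) q \<noteq> 0"
begin

text \<open>
  The recurrence is the vanishing of the \<open>q\<close>-integral of the \<open>q\<close>-derivative of
  \<open>(u - x) P\<^sub>j\<^sub>+\<^sub>1(x) w(x)\<close>, a function which vanishes at \<open>u\<close> because of its first factor and at
  \<open>v\<close> because of its second; \<open>w(q x)\<close> is turned into \<open>w(x)\<close> by the dilation rule for the weight.
\<close>
lemma qbeta_cauchy_moment_Suc:
  defines "N \<equiv> \<lambda>j. jackson_integral q u v (\<lambda>x. cauchy_poly q v j x * qbeta_weight q u v c d x)"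
  shows "(1 - c * d * u * v * q ^ j) * N (Suc j)
         = u * (1 - c * v * q ^ j) * (1 - d * v * q ^ j) * N j"
proof -
  let ?w = "qbeta_weight q u v c d" and ?P = "cauchy_poly q v"
  define g where "g = (\<lambda>x. (1 - x / u) * ?P (Suc j) x * ?w x)"
  define k1 where "k1 = c * d * u * v * q ^ j - 1"
  define k0 where "k0 = u * (1 - c * v * q ^ j) * (1 - d * v * q ^ j)"
  \<comment> \<open>The coefficients are those of \<open>P\<^sub>j\<^sub>+\<^sub>1\<close> and \<open>P\<^sub>j\<close> in the \<open>q\<close>-derivative after division by \<open>w(x)\<close>.\<close>
  define f where "f = (\<lambda>x. k1 * (?P (Suc j) x * ?w x) + k0 * (?P j x * ?w x))"
  note cont = isCont_cauchy_poly isCont_qbeta_weight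
  have "jackson_integral q u v f = 0"
  proof (rule jackson_integral_q_derivative_eq_0[OF q, where g = "\<lambda>x. u * g x"])
    show "isCont (\<lambda>x. u * g x) 0" unfolding g_def
      using uv by (intro isCont_mult isCont_diff isCont_divide continuous_const continuous_ident cont)
    show "u * g u = 0" "u * g v = 0"
      using uv by (simp_all add: g_def cauchy_poly_Suc_self)
  next
    fix x assume x: "x \<in> qlattice q u v"
    have "(1 - q * x / u) * (1 - q * x / v) * ?w (q * x) = (1 - c * x) * (1 - d * x) * ?w x"
      by (intro qbeta_weight_dilate qpoch_inf_nonzero_on_qlattice[OF q _ _ x] cu cv du dv)
    hence e1: "(- v * q ^ j * ?P j x) * ((1 - q * x / u) * (1 - q * x / v) * ?w (q * x))
       = (- v * q ^ j * ?P j x) * ((1 - c * x) * (1 - d * x) * ?w x)"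
      by simp
    have e2: "(- v * q ^ j * ?P j x) * ((1 - q * x / u) * (1 - q * x / v) * ?w (q * x)) = g (q * x)"
      using uv unfolding g_def cauchy_poly_Suc_dilate by (simp add: field_simps)
    have gq: "g (q * x) = - v * q ^ j * ?P j x * ((1 - c * x) * (1 - d * x) * ?w x)"
      by (rule trans[OF e2[symmetric] e1])
    show "x * f x = u * g x - u * g (q * x)"
      unfolding gq unfolding f_def g_def k0_def k1_def cauchy_poly_Suc using uv
      by (simp add: field_simps)
  qed
  moreover have "jackson_integral q u v f = k1 * N (Suc j) + k0 * N j"
    unfolding f_def N_def
    by (subst jackson_integral_add[OF q])
       (simp_all only: jackson_integral_cmult[OF q] isCont_mult continuous_const cont)
  ultimately show ?thesis by (simp add: k0_def k1_def algebra_simps)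
qed

lemma qbeta_cauchy_moment:
  assumes cduv: "qpoch_inf (c * d * u * v) q \<noteq> 0"
  shows "jackson_integral q u v (\<lambda>x. cauchy_poly q v j x * qbeta_weight q u v c d x)
         = jackson_integral q u v (qbeta_weight q u v c d)
           * (qpochs [c * v, d * v] q j / qpoch (c * d * u * v) q j) * u ^ j"
proof (induction j)
  case 0
  show ?case by (simp add: qpochs_def)
next
  case (Suc j)
  have "1 - c * d * u * v * q ^ j \<noteq> 0" "qpoch (c * d * u * v) q j \<noteq> 0"
    using qpoch_nonzero[OF q cduv, of "Suc j"] by (auto simp: qpoch_Suc)
  thus ?case
    using qbeta_cauchy_moment_Suc[of j] unfolding Suc.IH
    by (simp add: qpochs_def qpoch_Suc field_simps)
qed

lemma qbeta_moment:
  assumes cduv: "qpoch_inf (c * d * u * v) q \<noteq> 0"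
  shows "jackson_integral q u v (\<lambda>x. x ^ n * qbeta_weight q u v c d x)
         = jackson_integral q u v (qbeta_weight q u v c d)
           * qbeta_moment_ratio q u v c d n"
proof -
  let ?w = "qbeta_weight q u v c d"
  have "jackson_integral q u v (\<lambda>x. x ^ n * ?w x)
      = jackson_integral q u v
          (\<lambda>x. \<Sum>j\<le>n. qbinom n j q * v ^ (n - j) * (cauchy_poly q v j x * ?w x))"
    by (rule jackson_integral_cong)
       (simp add: power_eq_sum_cauchy_poly[of _ n v] sum_distrib_right mult.assoc)
  also have "\<dots>
      = (\<Sum>j\<le>n. qbinom n j q * v ^ (n - j) * jackson_integral q u v (\<lambda>x. cauchy_poly q v j x * ?w x))"
    by (subst jackson_integral_sum[OF q])
       (simp_all add: jackson_integral_cmult[OF q] isCont_cauchy_poly isCont_qbeta_weight)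
  also have "\<dots> = jackson_integral q u v ?w * 
      (\<Sum>j\<le>n. qbinom n j q * (qpochs [c * v, d * v] q j / qpoch (c * d * u * v) q j)
                * u ^ j * v ^ (n - j))"
    unfolding qbeta_cauchy_moment[OF cduv] sum_distrib_left
    by (intro sum.cong refl) (simp only: mult_ac)
  finally show ?thesis by (simp add: qbeta_moment_ratio_def)
qed

text \<open>
  Replacing \<open>c\<close> by \<open>c q\<close> multiplies the weight by \<open>1 - c x = (1 - c v) - c P\<^sub>1(x)\<close>, so the new mass is a
  combination of the first two Cauchy moments, and the recurrence eliminates the second one.
\<close>
lemma qbeta_integral_q_shift:
  "(1 - c * d * u * v) * jackson_integral q u v (qbeta_weight q u v (c * q) d)
   = (1 - c * u) * (1 - c * v) * jackson_integral q u v (qbeta_weight q u v c d)"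
proof -
  let ?w = "qbeta_weight q u v c d" and ?J = "jackson_integral q u v"
  let ?N = "?J (\<lambda>x. cauchy_poly q v (Suc 0) x * ?w x)"
  note cont = isCont_cauchy_poly isCont_qbeta_weight
  have "?J (qbeta_weight q u v (c * q) d)
      = ?J (\<lambda>x. (1 - c * v) * ?w x + (- c) * (cauchy_poly q v (Suc 0) x * ?w x))"
  proof (rule jackson_integral_cong)
    fix x assume "x \<in> qlattice q u v"
    hence "qpoch_inf (c * x) q \<noteq> 0" by (rule qpoch_inf_nonzero_on_qlattice[OF q cu cv])
    thus "qbeta_weight q u v (c * q) d x
        = (1 - c * v) * ?w x + (- c) * (cauchy_poly q v (Suc 0) x * ?w x)"
      by (simp add: qbeta_weight_q_shift cauchy_poly_Suc algebra_simps)
  qed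
  also have "\<dots> = ?J (\<lambda>x. (1 - c * v) * ?w x) + ?J (\<lambda>x. (- c) * (cauchy_poly q v (Suc 0) x * ?w x))"
    by (intro jackson_integral_add[OF q] isCont_mult continuous_const cont)
  also have "\<dots> = (1 - c * v) * ?J ?w + (- c) * ?N"
    by (intro arg_cong2[where f = "(+)"] jackson_integral_cmult[OF q] isCont_mult cont)
  finally have shift: "?J (qbeta_weight q u v (c * q) d) = (1 - c * v) * ?J ?w - c * ?N"
    by simp
  have alg: "(1 - K) * ((1 - c * v) * A - c * B) = (1 - K) * (1 - c * v) * A - c * ((1 - K) * B)"
    for K A B by (simp add: algebra_simps)
  have "(1 - c * d * u * v) * ?N = u * (1 - c * v) * (1 - d * v) * ?J ?w"
    using qbeta_cauchy_moment_Suc[of 0] by simp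
  hence "(1 - c * d * u * v) * ?J (qbeta_weight q u v (c * q) d)
      = (1 - c * d * u * v) * (1 - c * v) * ?J ?w - c * (u * (1 - c * v) * (1 - d * v) * ?J ?w)"
    using alg[of "c * d * u * v" "?J ?w" ?N] by (simp only: shift)
  thus ?thesis by (simp add: algebra_simps)
qed

end

end

section \<open>The Andrews--Askey integral\<close>

context
  fixes q u v :: complex
  assumes q: "norm q < 1" and uv: "u \<noteq> 0" "v \<noteq> 0"
begin

text \<open>
  The parameter \<open>c\<close> enters through \<open>1 / (c q\<^sup>n x; q)\<^sub>\<infinity>\<close>, the value of one fixed function at the lattice
  point \<open>q\<^sup>n x\<close>. Hence it is bounded uniformly in \<open>n\<close> and tends to 1.
\<close>
lemma qbeta_integral_tendsto:
  "(\<lambda>n. jackson_integral q u v (qbeta_weight q u v (c * q ^ n) d))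
     \<longlonglongrightarrow> jackson_integral q u v (qbeta_weight q u v 0 d)"
proof -
  define h where "h = (\<lambda>y. inverse (qpoch_inf (c * y) q))"
  have h: "isCont h 0" unfolding h_def
    by (intro continuous_intros isCont_qpoch_inf[OF q]) auto
  have w_eq: "qbeta_weight q u v (c * q ^ n) d x = qbeta_weight q u v 0 d x * h (x * q ^ n)" for n x
    by (simp add: qbeta_weight_def h_def field_simps)
  obtain B1 where B1: "\<And>x. x \<in> qlattice q u v \<Longrightarrow> norm (qbeta_weight q u v 0 d x) \<le> B1"
    using isCont_0_bounded_on_qlattice[OF q isCont_qbeta_weight[OF q]] by metis
  obtain B2 where B2: "B2 > 0" "\<And>x. x \<in> qlattice q u v \<Longrightarrow> norm (h x) \<le> B2"
    using isCont_0_bounded_on_qlattice[OF q h] by metis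
  show ?thesis
  proof (rule jackson_integral_tendsto[OF q, where B = "B1 * B2"])
    fix x
    have "(\<lambda>n. qbeta_weight q u v 0 d x * h (x * q ^ n)) \<longlonglongrightarrow> qbeta_weight q u v 0 d x * h 0"
      by (intro tendsto_mult tendsto_const isCont_tendsto_compose[OF h] q_pow_tendsto_0 q)
    thus "(\<lambda>n. qbeta_weight q u v (c * q ^ n) d x) \<longlonglongrightarrow> qbeta_weight q u v 0 d x"
      by (simp add: w_eq) (simp add: h_def)
  next
    fix n x assume x: "x \<in> qlattice q u v"
    hence "x * q ^ n \<in> qlattice q u v"
      by (auto elim!: qlatticeE simp: mult.assoc power_add[symmetric])
    thus "norm (qbeta_weight q u v (c * q ^ n) d x) \<le> B1 * B2"
      unfolding w_eq norm_mult using B1[OF x] B2(2) B2(1)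
      by (intro mult_mono order_trans[OF norm_ge_zero B1[OF x]]) auto
  qed
qed

text \<open>
  Iterate the shift \<open>c \<mapsto> c q\<close> and let the number of steps tend to infinity.
\<close>
lemma qbeta_integral_remove_parameter:
  assumes cu: "qpoch_inf (c * u) q \<noteq> 0" and cv: "qpoch_inf (c * v) q \<noteq> 0"
    and du: "qpoch_inf (d * u) q \<noteq> 0" and dv: "qpoch_inf (d * v) q \<noteq> 0"
  shows "qpoch_inf (c * u) q * qpoch_inf (c * v) q * jackson_integral q u v (qbeta_weight q u v c d)
         = qpoch_inf (c * d * u * v) q * jackson_integral q u v (qbeta_weight q u v 0 d)"
proof -
  define A where "A = (\<lambda>n. jackson_integral q u v (qbeta_weight q u v (c * q ^ n) d))"
  have iter: "qpoch (c * u) q n * qpoch (c * v) q n * A 0 = qpoch (c * d * u * v) q n * A n" for n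
  proof (induction n)
    case (Suc n)
    have "qpoch_inf (c * q ^ n * u) q \<noteq> 0" "qpoch_inf (c * q ^ n * v) q \<noteq> 0"
      using qpoch_inf_q_pow_nonzero[OF q cu, of n] qpoch_inf_q_pow_nonzero[OF q cv, of n]
      by (simp_all add: mult_ac)
    from qbeta_integral_q_shift[OF q uv this du dv]
    have step: "(1 - c * d * u * v * q ^ n) * A (Suc n)
        = (1 - c * u * q ^ n) * (1 - c * v * q ^ n) * A n"
      by (simp add: A_def mult_ac)
    have "qpoch (c * u) q (Suc n) * qpoch (c * v) q (Suc n) * A 0
        = (1 - c * u * q ^ n) * (1 - c * v * q ^ n) * (qpoch (c * u) q n * qpoch (c * v) q n * A 0)"
      by (simp add: qpoch_Suc mult_ac)
    also have "\<dots> = qpoch (c * d * u * v) q n * ((1 - c * u * q ^ n) * (1 - c * v * q ^ n) * A n)"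
      unfolding Suc.IH by (simp add: mult_ac)
    also have "\<dots> = qpoch (c * d * u * v) q (Suc n) * A (Suc n)"
      unfolding step[symmetric] by (simp add: qpoch_Suc mult_ac)
    finally show ?case .
  qed simp
  have "(\<lambda>n. qpoch (c * u) q n * qpoch (c * v) q n * A 0)
      \<longlonglongrightarrow> qpoch_inf (c * u) q * qpoch_inf (c * v) q * A 0"
    by (intro tendsto_intros qpoch_tendsto_qpoch_inf[OF q])
  moreover have "(\<lambda>n. qpoch (c * d * u * v) q n * A n)
      \<longlonglongrightarrow> qpoch_inf (c * d * u * v) q * jackson_integral q u v (qbeta_weight q u v 0 d)"
    unfolding A_def by (intro tendsto_intros qpoch_tendsto_qpoch_inf[OF q] qbeta_integral_tendsto)
  ultimately have "qpoch_inf (c * u) q * qpoch_inf (c * v) q * A 0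
      = qpoch_inf (c * d * u * v) q * jackson_integral q u v (qbeta_weight q u v 0 d)"
    unfolding iter by (rule LIMSEQ_unique)
  thus ?thesis by (simp add: A_def)
qed

lemma qbeta_integral_remove_parameters:
  assumes cu: "qpoch_inf (c * u) q \<noteq> 0" and cv: "qpoch_inf (c * v) q \<noteq> 0"
    and du: "qpoch_inf (d * u) q \<noteq> 0" and dv: "qpoch_inf (d * v) q \<noteq> 0"
  shows "qpochs_inf [c * u, c * v, d * u, d * v] q * jackson_integral q u v (qbeta_weight q u v c d)
         = qpoch_inf (c * d * u * v) q * jackson_integral q u v (qbeta_weight q u v 0 0)"
proof -
  have "qpoch_inf (d * u) q * qpoch_inf (d * v) q * jackson_integral q u v (qbeta_weight q u v 0 d)
      = jackson_integral q u v (qbeta_weight q u v 0 0)"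
    using qbeta_integral_remove_parameter[of d 0] du dv
    by (simp add: qbeta_weight_commute[of q u v 0 d])
  note d = this
  have "qpochs_inf [c * u, c * v, d * u, d * v] q * jackson_integral q u v (qbeta_weight q u v c d)
      = qpoch_inf (d * u) q * qpoch_inf (d * v) q
        * (qpoch_inf (c * u) q * qpoch_inf (c * v) q * jackson_integral q u v (qbeta_weight q u v c d))"
    by (simp add: qpochs_inf_def mult_ac)
  also have "\<dots> = qpoch_inf (c * d * u * v) q
      * (qpoch_inf (d * u) q * qpoch_inf (d * v) q * jackson_integral q u v (qbeta_weight q u v 0 d))"
    unfolding qbeta_integral_remove_parameter[OF cu cv du dv] by (simp only: mult_ac)
  finally show ?thesis unfolding d .
qed

text \<open>
  This evaluation is equivalent to Jacobi's triple product identity. It comes for free from the removal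
  of parameters, read backwards: for \<open>c = q/u\<close> and \<open>d = q/v\<close> the weight is identically 1 on the lattice
  and the integral is \<open>v - u\<close>. That choice is forbidden only if one of \<open>u, v\<close> is a positive power of \<open>q\<close> times the
  other. Then both sides vanish, since the weight is zero at the lattice points lying between the
  endpoints.
\<close>
lemma qbeta_integral_0_0:
  "jackson_integral q u v (qbeta_weight q u v 0 0)
     = (1 - q) * v * qpochs_inf [q, u / v, q * v / u] q"
proof -
  let ?J = "jackson_integral q u v (qbeta_weight q u v 0 0)"
  have cont: "isCont (qbeta_weight q u v 0 0) 0"
    by (rule isCont_qbeta_weight[OF q])
  consider k where "1 - q * v / u * q ^ k = 0" | k where "1 - q * u / v * q ^ k = 0"
    | "qpoch_inf (q * v / u) q \<noteq> 0" "qpoch_inf (q * u / v) q \<noteq> 0"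
    by (auto simp: qpoch_inf_eq_0_iff[OF q])
  thus ?thesis
  proof cases
    case 1
    hence u: "u = v * q ^ Suc k" using uv by (simp add: field_simps)
    have "?J = 0"
    proof (rule jackson_integral_eq_0_if_commensurable[OF q u cont])
      fix n assume "n < Suc k"
      hence "q * (v * q ^ n) / u * q ^ (k - n) = 1"
        using u uv by (auto simp: field_simps power_add[symmetric])
      hence "qpoch_inf (q * (v * q ^ n) / u) q = 0"
        unfolding qpoch_inf_eq_0_iff[OF q] by (intro exI[of _ "k - n"]) simp
      thus "qbeta_weight q u v 0 0 (v * q ^ n) = 0" by (simp add: qbeta_weight_def)
    qed
    moreover have "qpoch_inf (q * v / u) q = 0"
      using 1 by (auto simp: qpoch_inf_eq_0_iff[OF q])
    ultimately show ?thesis by (simp add: qpochs_inf_def)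
  next
    case 2
    hence v: "v = u * q ^ Suc k" using uv by (simp add: field_simps)
    have "jackson_integral q v u (qbeta_weight q u v 0 0) = 0"
    proof (rule jackson_integral_eq_0_if_commensurable[OF q v cont])
      fix n assume "n < Suc k"
      hence "q * (u * q ^ n) / v * q ^ (k - n) = 1"
        using v uv by (auto simp: field_simps power_add[symmetric])
      hence "qpoch_inf (q * (u * q ^ n) / v) q = 0"
        unfolding qpoch_inf_eq_0_iff[OF q] by (intro exI[of _ "k - n"]) simp
      thus "qbeta_weight q u v 0 0 (u * q ^ n) = 0" by (simp add: qbeta_weight_def)
    qed
    hence "?J = 0" using jackson_integral_swap[OF q cont, of u v] by simp
    moreover have "u / v * q ^ Suc k = q * u / v * q ^ k" by simp
    hence "qpoch_inf (u / v) q = 0"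
      unfolding qpoch_inf_eq_0_iff[OF q] using 2 by metis
    ultimately show ?thesis by (simp add: qpochs_inf_def)
  next
    case 3
    note q1 = qpoch_inf_nonzero_if_norm_less_1[OF q q]
    have ne: "qpoch_inf (q / u * u) q \<noteq> 0" "qpoch_inf (q / u * v) q \<noteq> 0"
      "qpoch_inf (q / v * u) q \<noteq> 0" "qpoch_inf (q / v * v) q \<noteq> 0"
      using 3 q1 uv by (simp_all add: mult_ac)
    have "jackson_integral q u v (qbeta_weight q u v (q / u) (q / v)) = jackson_integral q u v (\<lambda>x. 1)"
    proof (rule jackson_integral_cong)
      fix x assume "x \<in> qlattice q u v"
      hence "qpoch_inf (q / u * x) q \<noteq> 0" "qpoch_inf (q / v * x) q \<noteq> 0"
        using qpoch_inf_nonzero_on_qlattice[OF q] ne by blast+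
      thus "qbeta_weight q u v (q / u) (q / v) x = 1"
        by (simp add: qbeta_weight_def)
    qed
    hence "qpochs_inf [q / u * u, q / u * v, q / v * u, q / v * v] q * (v - u)
        = qpoch_inf (q / u * (q / v) * u * v) q * ?J"
      using qbeta_integral_remove_parameters[OF ne] by (simp add: jackson_integral_const[OF q])
    hence e: "qpoch_inf (q * q) q * ?J
        = qpoch_inf q q * qpoch_inf (q * v / u) q * qpoch_inf (q * u / v) q * qpoch_inf q q * (v - u)"
      using uv by (simp add: qpochs_inf_def mult_ac)
    have vu: "v - u = v * (1 - u / v)" using uv by (simp add: field_simps)
    have uv1: "qpoch_inf (u / v) q = (1 - u / v) * qpoch_inf (q * u / v) q"
      using qpoch_inf_step[OF q, of "u / v"] by (simp add: mult_ac)
    have q2: "qpoch_inf q q = (1 - q) * qpoch_inf (q * q) q"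
      by (rule qpoch_inf_step[OF q])
    have "qpoch_inf (q * q) q * ?J
        = qpoch_inf (q * q) q
          * ((1 - q) * v * (qpoch_inf q q * qpoch_inf (u / v) q * qpoch_inf (q * v / u) q))"
      unfolding e uv1 vu q2 by (simp only: mult_ac)
    hence "qpoch_inf (q * q) q * ?J
        = qpoch_inf (q * q) q * ((1 - q) * v * qpochs_inf [q, u / v, q * v / u] q)"
      by (simp add: qpochs_inf_def mult.assoc)
    thus ?thesis using q1 q2 by auto
  qed
qed

theorem andrews_askey_integral:
  assumes "qpoch_inf (c * u) q \<noteq> 0" "qpoch_inf (c * v) q \<noteq> 0"
    "qpoch_inf (d * u) q \<noteq> 0" "qpoch_inf (d * v) q \<noteq> 0"
  shows "jackson_integral q u v (qbeta_weight q u v c d)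
         = (1 - q) * v * qpochs_inf [q, u / v, q * v / u, c * d * u * v] q
           / qpochs_inf [c * u, c * v, d * u, d * v] q"
  using qbeta_integral_remove_parameters[OF assms] assms
  unfolding qbeta_integral_0_0 by (simp add: qpochs_inf_def field_simps)

end

section \<open>Term-by-term integration for small parameters\<close>

definition Phi_quotient ::
  "complex \<Rightarrow> complex \<Rightarrow> complex \<Rightarrow> complex \<Rightarrow> complex \<Rightarrow> complex \<Rightarrow> complex" where
  "Phi_quotient q \<alpha> \<beta> a b y = qpochs_inf [\<alpha> * a * y, \<beta> * b * y] q / qpochs_inf [a * y, b * y] q"

lemma norm_convolution_le:
  fixes c :: "nat \<Rightarrow> complex" and x y :: complex
  assumes "\<And>k. k \<le> n \<Longrightarrow> norm (c k) \<le> C"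
  shows "norm (\<Sum>k\<le>n. c k * x ^ k * y ^ (n - k)) \<le> C * real (Suc n) * max (norm x) (norm y) ^ n"
proof -
  let ?M = "max (norm x) (norm y)"
  have "norm (\<Sum>k\<le>n. c k * x ^ k * y ^ (n - k)) \<le> (\<Sum>k\<le>n. C * ?M ^ n)"
  proof (rule sum_norm_le)
    fix k assume k: "k \<in> {..n}"
    have "norm (c k * x ^ k * y ^ (n - k)) = norm (c k) * (norm x ^ k * norm y ^ (n - k))"
      by (simp add: norm_mult norm_power)
    also have "\<dots> \<le> C * (?M ^ k * ?M ^ (n - k))"
      using assms[of k] k order_trans[OF norm_ge_zero assms[of k]]
      by (intro mult_mono power_mono) (auto intro!: zero_le_power simp: le_max_iff_disj)
    also have "?M ^ k * ?M ^ (n - k) = ?M ^ n"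
      using k by (simp add: power_add[symmetric])
    finally show "norm (c k * x ^ k * y ^ (n - k)) \<le> C * ?M ^ n" .
  qed
  thus ?thesis by (simp add: mult_ac)
qed

lemma max_norm_product_less_1:
  fixes a b u v :: complex
  assumes "\<And>z x. z \<in> {a, b} \<Longrightarrow> x \<in> {u, v} \<Longrightarrow> norm (z * x) < 1"
  shows "max (norm a) (norm b) * max (norm u) (norm v) < 1"
  using assms[of a u] assms[of a v] assms[of b u] assms[of b v]
  by (auto simp: norm_mult max_def)

text \<open>The second derivative of the geometric series is a majorant.\<close>
lemma summable_Suc_square_mult_power:
  assumes "0 \<le> r" "r < 1"
  shows "summable (\<lambda>n. real (Suc n) ^ 2 * r ^ n)"
proof -
  have 1: "summable (\<lambda>n. diffs (\<lambda>_. 1) n * x ^ n)" if "norm x < 1" for x :: real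
    by (rule termdiff_converges[OF that]) (auto intro: summable_geometric)
  have "summable (\<lambda>n. diffs (diffs (\<lambda>_. 1)) n * r ^ n)"
    by (rule termdiff_converges[of r 1]) (use assms 1 in auto)
  moreover have "real (Suc n) ^ 2 * r ^ n \<le> diffs (diffs (\<lambda>_. 1)) n * r ^ n" for n
    using assms by (intro mult_right_mono) (auto simp: diffs_def power2_eq_square)
  ultimately show ?thesis
    using assms by (intro summable_comparison_test'[of _ 0 "\<lambda>n. real (Suc n) ^ 2 * r ^ n"]) auto
qed

context
  fixes q :: complex
  assumes q: "norm q < 1"
begin

lemma Phi_divide_qpoch:
  "Phi n \<alpha> \<beta> a b q / qpoch q q n
     = (\<Sum>k\<le>n. (qpoch \<alpha> q k / qpoch q q k * (qpoch \<beta> q (n - k) / qpoch q q (n - k))) * a ^ k * b ^ (n - k))"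
  unfolding Phi_def sum_divide_distrib
  using qpoch_q_nonzero[OF q] by (intro sum.cong refl) (simp add: qbinom_def field_simps)

text \<open>
  The Cauchy product of the two \<open>q\<close>-binomial series for \<open>a\<close> and \<open>b\<close>.
\<close>
lemma Phi_generating_function:
  assumes "norm (a * y) < 1" "norm (b * y) < 1"
  shows "(\<lambda>n. Phi n \<alpha> \<beta> a b q / qpoch q q n * y ^ n) sums Phi_quotient q \<alpha> \<beta> a b y"
proof -
  let ?f = "\<lambda>k. qpoch \<alpha> q k / qpoch q q k * (a * y) ^ k"
  let ?g = "\<lambda>k. qpoch \<beta> q k / qpoch q q k * (b * y) ^ k"
  have "(\<lambda>n. \<Sum>k\<le>n. ?f k * ?g (n - k)) sums ((\<Sum>k. ?f k) * (\<Sum>k. ?g k))"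
    using assms by (intro Cauchy_product_sums q_binomial_theorem(1)[OF q])
  also have "(\<Sum>k. ?f k) * (\<Sum>k. ?g k) = Phi_quotient q \<alpha> \<beta> a b y"
    using q_binomial_theorem(2)[OF q assms(1), of \<alpha>] q_binomial_theorem(2)[OF q assms(2), of \<beta>]
    by (simp add: Phi_quotient_def qpochs_inf_def sums_iff mult_ac)
  also have "(\<lambda>n. \<Sum>k\<le>n. ?f k * ?g (n - k)) = (\<lambda>n. Phi n \<alpha> \<beta> a b q / qpoch q q n * y ^ n)"
  proof
    fix n
    have "y ^ n = y ^ k * y ^ (n - k)" if "k \<le> n" for k
      using that by (simp add: power_add[symmetric])
    thus "(\<Sum>k\<le>n. ?f k * ?g (n - k)) = Phi n \<alpha> \<beta> a b q / qpoch q q n * y ^ n"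
      unfolding Phi_divide_qpoch sum_distrib_right
      by (intro sum.cong refl) (simp add: power_mult_distrib mult_ac)
  qed
  finally show ?thesis .
qed

lemma Phi_bound:
  obtains C where "C > 0"
    "\<And>n. norm (Phi n \<alpha> \<beta> a b q / qpoch q q n) \<le> C * real (Suc n) * max (norm a) (norm b) ^ n"
proof -
  note ne = qpoch_inf_nonzero_if_norm_less_1[OF q q]
  obtain A where A: "A > 0" "\<And>n. norm (qpoch \<alpha> q n / qpoch q q n) \<le> A"
    using qpoch_ratio_bounded[OF q ne] by metis
  obtain B where B: "B > 0" "\<And>n. norm (qpoch \<beta> q n / qpoch q q n) \<le> B"
    using qpoch_ratio_bounded[OF q ne] by metis
  show ?thesis
  proof
    show "A * B > 0" using A B by simp
    fix n
    show "norm (Phi n \<alpha> \<beta> a b q / qpoch q q n) \<le> A * B * real (Suc n) * max (norm a) (norm b) ^ n"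
      unfolding Phi_divide_qpoch
      by (rule norm_convolution_le, subst norm_mult, intro mult_mono A B) (use A in auto)
  qed
qed

lemma qbeta_moment_ratio_bound:
  assumes "qpoch_inf (c * d * u * v) q \<noteq> 0"
  obtains C where "C > 0"
    "\<And>n. norm (qbeta_moment_ratio q u v c d n) \<le> C * real (Suc n) * max (norm u) (norm v) ^ n"
proof -
  define E where "E = (\<lambda>a::complex. exp (norm a / (1 - norm q)))"
  have E: "norm (qpoch a q n) \<le> E a" "E a > 0" for a n
    using norm_qpoch_le[OF q, of a n] by (simp_all add: E_def)
  obtain B where "B > 0" "\<And>n. norm (qpoch 0 q n / qpoch q q n) \<le> B"
    using qpoch_ratio_bounded[OF q qpoch_inf_nonzero_if_norm_less_1[OF q q]] by metis
  hence B: "B > 0" "\<And>n. norm (1 / qpoch q q n) \<le> B"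
    by simp_all
  obtain A where A: "A > 0" "\<And>n. norm (qpoch (c * v) q n / qpoch (c * d * u * v) q n) \<le> A"
    using qpoch_ratio_bounded[OF q assms] by metis
  have "norm (qbinom n j q) \<le> E q * (B * B)" for n j
  proof -
    have "norm (qbinom n j q) = norm (qpoch q q n) * (norm (1 / qpoch q q j) * norm (1 / qpoch q q (n - j)))"
      by (simp add: qbinom_def norm_mult norm_divide)
    also have "\<dots> \<le> E q * (B * B)"
      using E(1)[of q n] E(2)[of q] B(1) by (intro mult_mono B(2)) auto
    finally show ?thesis .
  qed
  moreover have "norm (qpochs [c * v, d * v] q j / qpoch (c * d * u * v) q j) \<le> A * E (d * v)" for j
  proof -
    have "norm (qpochs [c * v, d * v] q j / qpoch (c * d * u * v) q j)
        = norm (qpoch (c * v) q j / qpoch (c * d * u * v) q j) * norm (qpoch (d * v) q j)"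
      by (simp add: qpochs_def norm_mult norm_divide)
    also have "\<dots> \<le> A * E (d * v)"
      using A(1) by (intro mult_mono A(2) E(1)) auto
    finally show ?thesis .
  qed
  moreover have "0 \<le> E q * (B * B)" using E(2)[of q] B(1) by simp
  ultimately have *: "norm (qbinom n j q * (qpochs [c * v, d * v] q j / qpoch (c * d * u * v) q j))
      \<le> E q * (B * B) * (A * E (d * v))" for n j
    unfolding norm_mult[of "qbinom n j q"] by (intro mult_mono) auto
  show ?thesis
  proof
    show "E q * (B * B) * (A * E (d * v)) > 0" using E(2) A(1) B(1) by simp
    show "norm (qbeta_moment_ratio q u v c d n)
        \<le> E q * (B * B) * (A * E (d * v)) * real (Suc n) * max (norm u) (norm v) ^ n" for n
      unfolding qbeta_moment_ratio_def by (rule norm_convolution_le) (rule *)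
  qed
qed

lemma summable_Phi_moment:
  assumes "\<And>z x. z \<in> {a, b} \<Longrightarrow> x \<in> {u, v} \<Longrightarrow> norm (z * x) < 1"
    and "qpoch_inf (c * d * u * v) q \<noteq> 0"
  shows "summable (\<lambda>n. Phi n \<alpha> \<beta> a b q / qpoch q q n * qbeta_moment_ratio q u v c d n)"
proof -
  define r where "r = max (norm a) (norm b) * max (norm u) (norm v)"
  have r: "0 \<le> r" "r < 1"
    using max_norm_product_less_1[OF assms(1)]
    by (auto simp: r_def le_max_iff_disj)
  obtain A where A: "A > 0" "\<And>n. norm (Phi n \<alpha> \<beta> a b q / qpoch q q n)
      \<le> A * real (Suc n) * max (norm a) (norm b) ^ n"
    using Phi_bound by metis
  obtain B where B: "B > 0" "\<And>n. norm (qbeta_moment_ratio q u v c d n)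
      \<le> B * real (Suc n) * max (norm u) (norm v) ^ n"
    using qbeta_moment_ratio_bound[OF assms(2)] by metis
  show ?thesis
  proof (rule summable_comparison_test')
    show "summable (\<lambda>n. A * B * (real (Suc n) ^ 2 * r ^ n))"
      by (intro summable_mult summable_Suc_square_mult_power r)
    fix n
    have "norm (Phi n \<alpha> \<beta> a b q / qpoch q q n * qbeta_moment_ratio q u v c d n)
        \<le> (A * real (Suc n) * max (norm a) (norm b) ^ n) * (B * real (Suc n) * max (norm u) (norm v) ^ n)"
      unfolding norm_mult[of _ "qbeta_moment_ratio q u v c d n"]
      by (intro mult_mono A(2) B(2)) (use A(1) in \<open>auto simp: le_max_iff_disj\<close>)
    also have "\<dots> = A * B * (real (Suc n) ^ 2 * r ^ n)"
      unfolding r_def power_mult_distrib by (simp add: power2_eq_square mult_ac)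
    finally show "norm (Phi n \<alpha> \<beta> a b q / qpoch q q n * qbeta_moment_ratio q u v c d n)
        \<le> A * B * (real (Suc n) ^ 2 * r ^ n)" .
  qed
qed

text \<open>
  For small \<open>a\<close> and \<open>b\<close> the generating function converges absolutely and uniformly on the whole
  lattice, so it can be integrated term by term.
\<close>
lemma integral_Phi_quotient_eq_series_small:
  assumes uv: "u \<noteq> 0" "v \<noteq> 0"
    and cd: "qpoch_inf (c * u) q \<noteq> 0" "qpoch_inf (c * v) q \<noteq> 0"
      "qpoch_inf (d * u) q \<noteq> 0" "qpoch_inf (d * v) q \<noteq> 0"
    and cduv: "qpoch_inf (c * d * u * v) q \<noteq> 0"
    and small: "\<And>z x. z \<in> {a, b} \<Longrightarrow> x \<in> {u, v} \<Longrightarrow> norm (z * x) < 1"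
  shows "jackson_integral q u v (\<lambda>x. Phi_quotient q \<alpha> \<beta> a b x * qbeta_weight q u v c d x)
         = jackson_integral q u v (qbeta_weight q u v c d)
           * (\<Sum>n. Phi n \<alpha> \<beta> a b q / qpoch q q n * qbeta_moment_ratio q u v c d n)"
proof -
  let ?w = "qbeta_weight q u v c d" and ?J = "jackson_integral q u v"
  define \<phi> where "\<phi> = (\<lambda>n. Phi n \<alpha> \<beta> a b q / qpoch q q n)"
  define M where "M = max (norm u) (norm v)"
  define r where "r = max (norm a) (norm b) * M"
  have M: "M \<ge> 0" by (auto simp: M_def le_max_iff_disj)
  have r: "0 \<le> r" "r < 1"
    using max_norm_product_less_1[OF small]
    by (auto simp: r_def M_def le_max_iff_disj)
  obtain A where A: "A > 0" "\<And>n. norm (\<phi> n) \<le> A * real (Suc n) * max (norm a) (norm b) ^ n"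
    using Phi_bound unfolding \<phi>_def by metis
  have sumM: "summable (\<lambda>n. norm (\<phi> n) * M ^ n)"
  proof (rule summable_comparison_test')
    show "summable (\<lambda>n. A * (real (Suc n) ^ 2 * r ^ n))"
      by (intro summable_mult summable_Suc_square_mult_power r)
    fix n
    have "norm (\<phi> n) * M ^ n \<le> A * real (Suc n) * max (norm a) (norm b) ^ n * M ^ n"
      by (intro mult_right_mono A(2)) (use M in auto)
    also have "\<dots> = A * (real (Suc n) * r ^ n)"
      by (simp add: r_def power_mult_distrib mult_ac)
    also have "\<dots> \<le> A * (real (Suc n) ^ 2 * r ^ n)"
      by (intro mult_left_mono mult_right_mono) (use A(1) r in \<open>auto simp: power2_eq_square\<close>)
    finally show "norm (norm (\<phi> n) * M ^ n) \<le> A * (real (Suc n) ^ 2 * r ^ n)"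
      using M by simp
  qed
  obtain B where B: "B > 0" "\<And>x. x \<in> qlattice q u v \<Longrightarrow> norm (?w x) \<le> B"
    using isCont_0_bounded_on_qlattice[OF q isCont_qbeta_weight[OF q]] by metis
  define f where "f = (\<lambda>N x. \<Sum>n<N. \<phi> n * (x ^ n * ?w x))"
  have f_eq: "f N x = (\<Sum>n<N. \<phi> n * x ^ n) * ?w x" for N x
    by (simp add: f_def sum_distrib_right mult.assoc)
  have "(\<lambda>N. ?J (f N)) \<longlonglongrightarrow> ?J (\<lambda>x. Phi_quotient q \<alpha> \<beta> a b x * ?w x)"
  proof (rule jackson_integral_tendsto[OF q, where B = "(\<Sum>n. norm (\<phi> n) * M ^ n) * B"])
    fix x assume x: "x \<in> qlattice q u v"
    have "norm (z * x) < 1" if z: "z \<in> {a, b}" for z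
    proof -
      have "norm (z * x) \<le> max (norm a) (norm b) * M"
        unfolding norm_mult M_def using z norm_qlattice_le[OF q x]
        by (intro mult_mono) (auto simp: le_max_iff_disj)
      thus ?thesis using r by (simp add: r_def)
    qed
    hence "(\<lambda>n. \<phi> n * x ^ n) sums Phi_quotient q \<alpha> \<beta> a b x"
      unfolding \<phi>_def by (intro Phi_generating_function) auto
    thus "(\<lambda>N. f N x) \<longlonglongrightarrow> Phi_quotient q \<alpha> \<beta> a b x * ?w x"
      unfolding f_eq sums_def by (intro tendsto_intros)
    fix N
    have "norm (\<Sum>n<N. \<phi> n * x ^ n) \<le> (\<Sum>n<N. norm (\<phi> n) * M ^ n)"
      using norm_qlattice_le[OF q x]
      by (intro sum_norm_le) (auto simp: norm_mult norm_power M_def intro!: mult_left_mono power_mono)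
    also have "\<dots> \<le> (\<Sum>n. norm (\<phi> n) * M ^ n)"
      by (rule sum_le_suminf[OF sumM]) (use M in auto)
    finally show "norm (f N x) \<le> (\<Sum>n. norm (\<phi> n) * M ^ n) * B"
      unfolding f_eq norm_mult
      by (intro mult_mono B(2)[OF x] suminf_nonneg sumM) (use M in auto)
  qed
  moreover have "?J (f N) = ?J ?w * (\<Sum>n<N. \<phi> n * qbeta_moment_ratio q u v c d n)" for N
  proof -
    have "?J (f N) = (\<Sum>n<N. \<phi> n * ?J (\<lambda>x. x ^ n * ?w x))"
      unfolding f_def
      by (subst jackson_integral_sum[OF q])
         (simp_all add: jackson_integral_cmult[OF q] continuous_intros isCont_qbeta_weight[OF q])
    thus ?thesis
      by (simp add: qbeta_moment[OF q uv cd cduv] sum_distrib_left mult.left_commute)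
  qed
  moreover have "(\<lambda>N. ?J ?w * (\<Sum>n<N. \<phi> n * qbeta_moment_ratio q u v c d n))
      \<longlonglongrightarrow> ?J ?w * (\<Sum>n. \<phi> n * qbeta_moment_ratio q u v c d n)"
    using summable_Phi_moment[OF small cduv] unfolding \<phi>_def
    by (intro tendsto_intros summable_LIMSEQ)
  ultimately show ?thesis
    unfolding \<phi>_def by (simp add: LIMSEQ_unique)
qed

end

section \<open>Abel's limit theorem\<close>

text \<open>
  The factor \<open>1 - t\<close> kills any finite number of terms, and the weights \<open>(1 - t) t\<^sup>n\<close> of the others,
  whose coefficients are small, add up to at most 1.
\<close>
lemma abel_mean_tendsto_0:
  fixes U :: "nat \<Rightarrow> complex"
  assumes U: "U \<longlonglongrightarrow> 0"
  shows "((\<lambda>t. (1 - of_real t) * (\<Sum>n. U n * of_real t ^ n)) \<longlongrightarrow> 0) (at_left (1::real))"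
proof (rule tendstoI)
  fix e :: real assume e: "e > 0"
  obtain N where N: "\<And>n. n \<ge> N \<Longrightarrow> norm (U n) < e / 2"
    using LIMSEQ_D[OF U, of "e / 2"] e by auto
  define C where "C = (\<Sum>n<N. norm (U n))"
  have C: "C \<ge> 0" by (auto simp: C_def intro: sum_nonneg)
  have "((\<lambda>t. (1 - t) * C) \<longlongrightarrow> (1 - 1) * C) (at_left (1::real))"
    by (intro tendsto_intros)
  hence "\<forall>\<^sub>F t in at_left 1. (1 - t) * C < e / 2"
    using e by (intro order_tendstoD) auto
  moreover have "\<forall>\<^sub>F t in at_left (1::real). 0 < t \<and> t < 1"
    unfolding eventually_at_left_field by (intro exI[of _ 0]) auto
  ultimately show "\<forall>\<^sub>F t in at_left 1. dist ((1 - of_real t) * (\<Sum>n. U n * of_real t ^ n)) 0 < e"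
  proof eventually_elim
    case (elim t)
    hence t: "0 < t" "t < 1" by auto
    define V where "V = (\<lambda>n. (if n < N then norm (U n) else 0) + e / 2 * t ^ n)"
    have "V sums (C + e / 2 * (1 / (1 - t)))"
      unfolding V_def C_def
      using sums_If_finite_set[of "{..<N}" "\<lambda>n. norm (U n)"] geometric_sums[of t] t
      by (intro sums_add sums_mult) auto
    moreover have UV: "norm (U n * of_real t ^ n) \<le> V n" for n
    proof (cases "n < N")
      case True
      have "norm (U n) * t ^ n \<le> norm (U n) * 1"
        using t by (intro mult_left_mono power_le_one) auto
      moreover have "e / 2 * t ^ n \<ge> 0" using t e by simp
      ultimately show ?thesis using True t by (simp add: V_def norm_mult norm_power)
    next
      case False
      hence "norm (U n) * t ^ n \<le> e / 2 * t ^ n"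
        using N[of n] t by (intro mult_right_mono) auto
      thus ?thesis using False t by (simp add: V_def norm_mult norm_power)
    qed
    ultimately have "norm (\<Sum>n. U n * of_real t ^ n) \<le> C + e / 2 * (1 / (1 - t))"
      using norm_suminf_le[of "\<lambda>n. U n * of_real t ^ n" V, OF UV] by (simp add: sums_iff)
    hence "(1 - t) * norm (\<Sum>n. U n * of_real t ^ n) \<le> (1 - t) * (C + e / 2 * (1 / (1 - t)))"
      using t by (intro mult_left_mono) auto
    also have "\<dots> = (1 - t) * C + e / 2"
      using t by (simp add: field_simps)
    also have "\<dots> < e" using elim by simp
    finally have "(1 - t) * norm (\<Sum>n. U n * of_real t ^ n) < e" .
    moreover have "norm (1 - of_real t :: complex) = 1 - t"
      using t by (metis abs_of_pos diff_gt_0_iff_gt norm_of_real of_real_1 of_real_diff)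
    ultimately show ?case by (simp add: norm_mult)
  qed
qed

text \<open>
  Abel's limit theorem. With the tails \<open>T\<^sub>n\<close> of the series, summation by parts gives
  \<open>\<Sum> f\<^sub>n t\<^sup>n = T\<^sub>0 - (1 - t) \<Sum> T\<^sub>n\<^sub>+\<^sub>1 t\<^sup>n\<close>, and the tails tend to 0.
\<close>
theorem abel_limit:
  fixes f :: "nat \<Rightarrow> complex"
  assumes f: "summable f"
  shows "((\<lambda>t. \<Sum>n. f n * of_real t ^ n) \<longlongrightarrow> (\<Sum>n. f n)) (at_left (1::real))"
proof -
  define T where "T = (\<lambda>n. \<Sum>k. f (k + n))"
  have fT: "f n = T n - T (Suc n)" for n
    using suminf_split_head[of "\<lambda>k. f (k + n)"] f by (simp add: T_def summable_iff_shift)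
  have T0: "T \<longlonglongrightarrow> 0"
    unfolding T_def by (rule suminf_exist_split2[OF f])
  have main: "(\<Sum>n. f n * of_real t ^ n) = T 0 - (1 - of_real t) * (\<Sum>n. T (Suc n) * of_real t ^ n)"
    if t: "0 < t" "t < 1" for t :: real
  proof -
    obtain B where B: "\<And>n. norm (T n) \<le> B"
      using convergent_imp_Bseq[OF convergentI[OF T0]] unfolding Bseq_def by blast
    have TS: "summable (\<lambda>n. T n * of_real t ^ n)"
      by (rule summable_comparison_test'[of "\<lambda>n. B * t ^ n" 0])
         (use t B in \<open>auto simp: norm_mult norm_power intro!: mult_right_mono summable_mult summable_geometric\<close>)
    have TS': "summable (\<lambda>n. T (Suc n) * of_real t ^ n)"
      by (rule summable_comparison_test'[of "\<lambda>n. B * t ^ n" 0])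
         (use t B in \<open>auto simp: norm_mult norm_power intro!: mult_right_mono summable_mult summable_geometric\<close>)
    have "(\<Sum>n. f n * of_real t ^ n) = (\<Sum>n. T n * of_real t ^ n) - (\<Sum>n. T (Suc n) * of_real t ^ n)"
      unfolding fT left_diff_distrib by (rule suminf_diff[OF TS TS', symmetric])
    also have "(\<Sum>n. T n * of_real t ^ n) = T 0 + (\<Sum>n. T (Suc n) * of_real t ^ Suc n)"
      using suminf_split_head[OF TS] by simp
    also have "(\<Sum>n. T (Suc n) * of_real t ^ Suc n) = of_real t * (\<Sum>n. T (Suc n) * of_real t ^ n)"
      by (subst suminf_mult[OF TS', symmetric]) (simp add: mult_ac)
    finally show ?thesis by (simp add: algebra_simps)
  qed
  have ev: "\<forall>\<^sub>F t in at_left (1::real). 0 < t \<and> t < 1"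
    unfolding eventually_at_left_field by (intro exI[of _ 0]) auto
  have "((\<lambda>t. T 0 - (1 - of_real t) * (\<Sum>n. T (Suc n) * of_real t ^ n)) \<longlongrightarrow> T 0 - 0)
      (at_left (1::real))"
    by (intro tendsto_diff tendsto_const abel_mean_tendsto_0 LIMSEQ_Suc T0)
  moreover have "T 0 = (\<Sum>n. f n)" by (simp add: T_def)
  ultimately show ?thesis
    by (subst tendsto_cong[OF eventually_mono[OF ev main]]) auto
qed

section \<open>Continuation in a scaling parameter\<close>

lemma Phi_homogeneous: "Phi n \<alpha> \<beta> (t * a) (t * b) q = Phi n \<alpha> \<beta> a b q * t ^ n"
proof -
  have "t ^ n = t ^ k * t ^ (n - k)" if "k \<le> n" for k
    using that by (simp add: power_add[symmetric])
  thus ?thesis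
    unfolding Phi_def sum_distrib_right
    by (intro sum.cong refl) (simp add: power_mult_distrib mult_ac)
qed

text \<open>
  The function \<open>Phi_quotient q \<alpha> \<beta> (t a) (t b)\<close> at the lattice point \<open>x q\<^sup>n\<close>, multiplied by
  \<open>(t a x, t b x, t a y, t b y; q)\<^sub>\<infinity>\<close> and continued over its poles in \<open>t\<close>. The factor does not depend on \<open>n\<close> and removes the poles at every lattice point,
  those of the other endpoint \<open>y\<close> included. What remains of \<open>(t a x; q)\<^sub>\<infinity>\<close> after cancelling the
  denominator \<open>(t a x q\<^sup>n; q)\<^sub>\<infinity>\<close> is the finite product \<open>(t a x; q)\<^sub>n\<close>.
\<close>
definition cleared_Phi_quotient ::
  "complex \<Rightarrow> complex \<Rightarrow> complex \<Rightarrow> complex \<Rightarrow> complex \<Rightarrow> complex \<Rightarrow> complex \<Rightarrow> nat \<Rightarrow> complex \<Rightarrow> complex" where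
  "cleared_Phi_quotient q \<alpha> \<beta> a b x y n t =
     qpochs_inf [\<alpha> * (t * a) * (x * q ^ n), \<beta> * (t * b) * (x * q ^ n)] q
       * qpochs [t * a * x, t * b * x] q n * qpochs_inf [t * a * y, t * b * y] q"

context
  fixes q :: complex
  assumes q: "norm q < 1"
begin

lemma cleared_Phi_quotient_eq:
  assumes "qpochs_inf [t * a * x, t * b * x] q \<noteq> 0"
  shows "qpochs_inf [t * a * x, t * b * x, t * a * y, t * b * y] q
           * Phi_quotient q \<alpha> \<beta> (t * a) (t * b) (x * q ^ n)
         = cleared_Phi_quotient q \<alpha> \<beta> a b x y n t"
  using assms qpoch_inf_split[OF q, of "t * a * x" n] qpoch_inf_split[OF q, of "t * b * x" n]
  by (simp add: cleared_Phi_quotient_def Phi_quotient_def qpochs_inf_def qpochs_def mult.assoc)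

lemma holomorphic_cleared_Phi_quotient:
  "cleared_Phi_quotient q \<alpha> \<beta> a b x y n holomorphic_on A"
  unfolding cleared_Phi_quotient_def[abs_def] qpochs_inf_def qpochs_def qpoch_def
  by (simp, intro holomorphic_intros holomorphic_qpoch_inf_compose[OF q])

text \<open>
  A bound uniform in \<open>n\<close> and \<open>t\<close>, so that the sum over the lattice converges uniformly in \<open>t\<close> and is
  therefore holomorphic.
\<close>
lemma cleared_Phi_quotient_bounded:
  obtains B where "B \<ge> 0"
    "\<And>n t. norm t \<le> 2 \<Longrightarrow> norm (cleared_Phi_quotient q \<alpha> \<beta> a b x y n t) \<le> B"
proof -
  define L where "L = (\<lambda>z::complex. exp (2 * norm z / (1 - norm q)))"
  have L: "exp (norm w / (1 - norm q)) \<le> L z" if "norm w \<le> 2 * norm z" for w z :: complex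
    using that q unfolding L_def by (intro iffD2[OF exp_le_cancel_iff] divide_right_mono) auto
  have L1: "norm (qpoch_inf w q) \<le> L z" "norm (qpoch w q n) \<le> L z" if "norm w \<le> 2 * norm z" for w z n
    using norm_qpoch_inf_le[OF q, of w] norm_qpoch_le[OF q, of w n] L[OF that] by auto
  have L0: "L z \<ge> 0" for z by (simp add: L_def)
  show ?thesis
  proof
    show "L (\<alpha> * a * x) * L (\<beta> * b * x) * (L (a * x) * L (b * x)) * (L (a * y) * L (b * y)) \<ge> 0"
      by (simp add: L_def)
    fix n and t :: complex assume t: "norm t \<le> 2"
    have le: "norm (t * z) \<le> 2 * norm z" for z
      unfolding norm_mult using t by (intro mult_right_mono) auto
    have le': "norm (t * z * q ^ n) \<le> 2 * norm z" for z
    proof -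
      have "norm (t * z) * norm q ^ n \<le> norm (t * z) * 1"
        by (intro mult_left_mono norm_q_pow_le_1[OF q]) auto
      thus ?thesis using le[of z] by (simp add: norm_mult norm_power)
    qed
    have bounds: "norm (\<alpha> * (t * a) * (x * q ^ n)) \<le> 2 * norm (\<alpha> * a * x)"
      "norm (\<beta> * (t * b) * (x * q ^ n)) \<le> 2 * norm (\<beta> * b * x)"
      "norm (t * a * x) \<le> 2 * norm (a * x)" "norm (t * b * x) \<le> 2 * norm (b * x)"
      "norm (t * a * y) \<le> 2 * norm (a * y)" "norm (t * b * y) \<le> 2 * norm (b * y)"
      using le'[of "\<alpha> * a * x"] le'[of "\<beta> * b * x"] le[of "a * x"] le[of "b * x"]
        le[of "a * y"] le[of "b * y"] by (simp_all add: mult_ac)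
    show "norm (cleared_Phi_quotient q \<alpha> \<beta> a b x y n t)
        \<le> L (\<alpha> * a * x) * L (\<beta> * b * x) * (L (a * x) * L (b * x)) * (L (a * y) * L (b * y))"
      unfolding cleared_Phi_quotient_def qpochs_inf_def qpochs_def
      by (simp add: norm_mult del: mult.assoc)
         (intro mult_mono L1 bounds mult_nonneg_nonneg L0 norm_ge_zero)
  qed
qed

text \<open>
  Scale \<open>a\<close> and \<open>b\<close> by \<open>t\<close>; since \<open>Phi\<close> is homogeneous, the right-hand side becomes a power series \<open>F\<close> in
  \<open>t\<close>, convergent in the unit disc as it converges at \<open>t = 1\<close>. The left-hand side is meromorphic in \<open>t\<close>; after
  multiplication by its denominators \<open>D\<close> it is a function \<open>E\<close> holomorphic beyond the unit disc. The
  identity is known for small \<open>t\<close>, extends to the disc by the identity theorem and to \<open>t = 1\<close> by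
  Abel's theorem. Division by \<open>D(1)\<close> is possible because the original integrand has no zero denominator.
\<close>
theorem integral_Phi_quotient_eq_series:
  assumes uv: "u \<noteq> 0" "v \<noteq> 0"
    and cd: "qpoch_inf (c * u) q \<noteq> 0" "qpoch_inf (c * v) q \<noteq> 0"
      "qpoch_inf (d * u) q \<noteq> 0" "qpoch_inf (d * v) q \<noteq> 0"
    and cduv: "qpoch_inf (c * d * u * v) q \<noteq> 0"
    and ab: "qpoch_inf (a * u) q \<noteq> 0" "qpoch_inf (a * v) q \<noteq> 0"
      "qpoch_inf (b * u) q \<noteq> 0" "qpoch_inf (b * v) q \<noteq> 0"
    and sum: "summable (\<lambda>n. Phi n \<alpha> \<beta> a b q / qpoch q q n * qbeta_moment_ratio q u v c d n)"
  shows "jackson_integral q u v (\<lambda>x. Phi_quotient q \<alpha> \<beta> a b x * qbeta_weight q u v c d x)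
         = jackson_integral q u v (qbeta_weight q u v c d)
           * (\<Sum>n. Phi n \<alpha> \<beta> a b q / qpoch q q n * qbeta_moment_ratio q u v c d n)"
proof -
  let ?w = "qbeta_weight q u v c d" and ?J = "jackson_integral q u v"
  define S where "S = (\<lambda>n. Phi n \<alpha> \<beta> a b q / qpoch q q n * qbeta_moment_ratio q u v c d n)"
  define F where "F = (\<lambda>t. \<Sum>n. S n * t ^ n)"
  define D where "D = (\<lambda>t. qpochs_inf [t * a * v, t * b * v, t * a * u, t * b * u] q)"
  define G where "G = (\<lambda>t. ?J (\<lambda>x. Phi_quotient q \<alpha> \<beta> (t * a) (t * b) x * ?w x))"
  define e where "e = (\<lambda>n t. (v * (cleared_Phi_quotient q \<alpha> \<beta> a b v u n t * ?w (v * q ^ n))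
      - u * (cleared_Phi_quotient q \<alpha> \<beta> a b u v n t * ?w (u * q ^ n))) * q ^ n)"
  define E where "E = (\<lambda>t. (1 - q) * (\<Sum>n. e n t))"

  have E_eq: "E t = D t * G t" if "D t \<noteq> 0" for t
  proof -
    have ne: "qpochs_inf [t * a * v, t * b * v] q \<noteq> 0" "qpochs_inf [t * a * u, t * b * u] q \<noteq> 0"
      using that by (auto simp: D_def qpochs_inf_def)
    have D_eq: "D t = qpochs_inf [t * a * u, t * b * u, t * a * v, t * b * v] q"
      by (simp add: D_def qpochs_inf_def mult_ac)
    have v: "cleared_Phi_quotient q \<alpha> \<beta> a b v u n t
        = D t * Phi_quotient q \<alpha> \<beta> (t * a) (t * b) (v * q ^ n)" for n
      unfolding D_def by (rule cleared_Phi_quotient_eq[OF ne(1), symmetric])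
    have u: "cleared_Phi_quotient q \<alpha> \<beta> a b u v n t
        = D t * Phi_quotient q \<alpha> \<beta> (t * a) (t * b) (u * q ^ n)" for n
      unfolding D_eq by (rule cleared_Phi_quotient_eq[OF ne(2), symmetric])
    have "isCont (\<lambda>x. Phi_quotient q \<alpha> \<beta> (t * a) (t * b) x * ?w x) 0"
      unfolding Phi_quotient_def qpochs_inf_def using isCont_qbeta_weight[OF q, of u v c d]
      by (simp, intro continuous_intros isCont_qpoch_inf[OF q]) auto
    hence "?J (\<lambda>x. D t * (Phi_quotient q \<alpha> \<beta> (t * a) (t * b) x * ?w x)) = D t * G t"
      unfolding G_def by (rule jackson_integral_cmult[OF q])
    thus ?thesis
      by (simp add: E_def e_def u v jackson_integral_def mult.assoc)
  qed

  \<comment> \<open>Any radius above 1 would do; the disc has to contain \<open>t = 1\<close> in its interior.\<close>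
  have hol_E: "E holomorphic_on ball 0 2"
  proof -
    obtain Bw where Bw: "\<And>x. x \<in> qlattice q u v \<Longrightarrow> norm (?w x) \<le> Bw"
      using isCont_0_bounded_on_qlattice[OF q isCont_qbeta_weight[OF q]] by metis
    obtain Bv where Bv: "Bv \<ge> 0" "\<And>n t. norm t \<le> 2 \<Longrightarrow> norm (cleared_Phi_quotient q \<alpha> \<beta> a b v u n t) \<le> Bv"
      using cleared_Phi_quotient_bounded by metis
    obtain Bu where Bu: "Bu \<ge> 0" "\<And>n t. norm t \<le> 2 \<Longrightarrow> norm (cleared_Phi_quotient q \<alpha> \<beta> a b u v n t) \<le> Bu"
      using cleared_Phi_quotient_bounded by metis
    have e_le: "norm (e n t) \<le> (norm v * (Bv * Bw) + norm u * (Bu * Bw)) * norm q ^ n"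
      if t: "t \<in> ball 0 2" for n t
    proof -
      let ?cv = "cleared_Phi_quotient q \<alpha> \<beta> a b v u n t * ?w (v * q ^ n)"
      let ?cu = "cleared_Phi_quotient q \<alpha> \<beta> a b u v n t * ?w (u * q ^ n)"
      have t2: "norm t \<le> 2" using t by simp
      have "norm ?cv \<le> Bv * Bw" "norm ?cu \<le> Bu * Bw"
        unfolding norm_mult by (intro mult_mono Bv Bu Bw t2; simp)+
      hence "norm v * norm ?cv + norm u * norm ?cu \<le> norm v * (Bv * Bw) + norm u * (Bu * Bw)"
        by (intro add_mono mult_left_mono) auto
      moreover have "norm (v * ?cv - u * ?cu) \<le> norm v * norm ?cv + norm u * norm ?cu"
        by (rule order_trans[OF norm_triangle_ineq4]) (simp add: norm_mult)
      ultimately show ?thesis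
        unfolding e_def norm_mult[of _ "q ^ n"] norm_power by (intro mult_right_mono) auto
    qed
    have ul: "uniform_limit (ball 0 2) (\<lambda>N t. \<Sum>n<N. e n t) (\<lambda>t. \<Sum>n. e n t) sequentially"
      by (rule Weierstrass_m_test[OF e_le summable_norm_q_pow[OF q]])
    have "(\<lambda>t. \<Sum>n. e n t) holomorphic_on ball 0 2"
    proof (rule holomorphic_uniform_sequence[where f = "\<lambda>N t. \<Sum>n<N. e n t"])
      show "(\<lambda>t. \<Sum>n<N. e n t) holomorphic_on ball 0 2" for N
        unfolding e_def by (intro holomorphic_intros holomorphic_cleared_Phi_quotient)
      fix t :: complex assume "t \<in> ball 0 2"
      then obtain r where "r > 0" "cball t r \<subseteq> ball 0 2"
        using open_contains_cball[THEN iffD1, OF open_ball] by blast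
      thus "\<exists>r>0. cball t r \<subseteq> ball 0 2 \<and>
          uniform_limit (cball t r) (\<lambda>N t. \<Sum>n<N. e n t) (\<lambda>t. \<Sum>n. e n t) sequentially"
        using uniform_limit_on_subset[OF ul] by blast
    qed auto
    thus ?thesis unfolding E_def by (intro holomorphic_intros)
  qed

  have hol_D: "D holomorphic_on A" for A
    unfolding D_def qpochs_inf_def
    by (simp, intro holomorphic_intros holomorphic_qpoch_inf_compose[OF q])

  have F_sums: "(\<lambda>n. S n * t ^ n) sums F t" if "norm t < 1" for t
    unfolding F_def
    by (rule summable_sums, rule powser_inside[of S 1]) (use sum that in \<open>auto simp: S_def\<close>)
  have hol_F: "F holomorphic_on ball 0 1"
    by (rule power_series_holomorphic[where a = S]) (use F_sums in auto)

  \<comment> \<open>For \<open>norm t < 1 / M\<close> the scaled parameters satisfy the smallness condition.\<close>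
  define M where "M = 1 + max (norm a) (norm b) * max (norm u) (norm v)"
  have M: "M \<ge> 1" by (auto simp: M_def le_max_iff_disj)
  have E_small: "E t = D t * (?J ?w * F t)" if t: "t \<in> ball 0 (1 / M)" for t
  proof -
    have small: "norm (z * x) < 1" if z: "z \<in> {t * a, t * b}" and x: "x \<in> {u, v}" for z x
    proof -
      obtain z' where z': "z = t * z'" "z' \<in> {a, b}" using z by auto
      have "norm z' * norm x \<le> max (norm a) (norm b) * max (norm u) (norm v)"
        using z' x by (intro mult_mono) (auto simp: le_max_iff_disj)
      hence "norm (z * x) \<le> norm t * M"
        unfolding z' norm_mult mult.assoc by (intro mult_left_mono) (auto simp: M_def)
      also have "\<dots> < 1" using t M by (simp add: field_simps)
      finally show ?thesis .
    qed
    have "D t \<noteq> 0"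
      using small[of "t * a" u] small[of "t * a" v] small[of "t * b" u] small[of "t * b" v]
      by (simp add: D_def qpochs_inf_def qpoch_inf_nonzero_if_norm_less_1[OF q])
    moreover have "G t = ?J ?w * F t"
      unfolding G_def F_def S_def
      using integral_Phi_quotient_eq_series_small[where \<alpha> = \<alpha> and \<beta> = \<beta> and a = "t * a" and b = "t * b",
          OF q uv cd cduv small]
      unfolding Phi_homogeneous by (simp add: mult_ac)
    ultimately show ?thesis using E_eq by simp
  qed
  have E_unit: "E t = D t * (?J ?w * F t)" if t: "t \<in> ball 0 1" for t
  proof (rule analytic_continuation_open[of "ball 0 (1 / M)" "ball 0 1" E "\<lambda>t. D t * (?J ?w * F t)"])
    show "ball 0 (1 / M) \<noteq> ({} :: complex set)" using M by simp
    show "ball 0 (1 / M) \<subseteq> (ball 0 1 :: complex set)" using M by (intro subset_ball) simp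
    show "E holomorphic_on ball 0 1"
      by (rule holomorphic_on_subset[OF hol_E]) (auto intro: subset_ball)
    show "(\<lambda>t. D t * (?J ?w * F t)) holomorphic_on ball 0 1"
      by (intro holomorphic_intros hol_D hol_F)
  qed (use t E_small in auto)

  have ev: "\<forall>\<^sub>F t in at_left (1::real). complex_of_real t \<in> ball 0 1"
    unfolding eventually_at_left_field by (intro exI[of _ 0]) auto
  have to1: "((\<lambda>t. complex_of_real t) \<longlongrightarrow> 1) (at_left (1::real))"
    using tendsto_of_real[OF tendsto_ident_at, of 1 "{..<1}"] by simp
  have "isCont E 1" "isCont D 1"
    using holomorphic_on_imp_continuous_on[OF hol_E] holomorphic_on_imp_continuous_on[OF hol_D[of UNIV]]
    by (auto simp: continuous_on_eq_continuous_at)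
  note lims = this[THEN isCont_tendsto_compose, OF to1]
  have "((\<lambda>t. D (of_real t) * (?J ?w * F (of_real t))) \<longlongrightarrow> D 1 * (?J ?w * (\<Sum>n. S n))) (at_left (1::real))"
    unfolding F_def by (intro tendsto_mult tendsto_const lims abel_limit) (use sum in \<open>simp add: S_def\<close>)
  moreover have "((\<lambda>t. D (of_real t) * (?J ?w * F (of_real t))) \<longlongrightarrow> E 1) (at_left (1::real))"
    by (rule Lim_transform_eventually[OF lims(1)]) (use ev E_unit in \<open>auto elim!: eventually_mono\<close>)
  ultimately have "E 1 = D 1 * (?J ?w * (\<Sum>n. S n))"
    using tendsto_unique[OF trivial_limit_at_left_real] by blast
  moreover have "D 1 \<noteq> 0" using ab by (simp add: D_def qpochs_inf_def)
  ultimately have "G 1 = ?J ?w * (\<Sum>n. S n)" using E_eq[of 1] by simp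
  thus ?thesis by (simp add: G_def S_def)
qed

end

theorem theorem6p3:
  fixes q a b c d u v \<alpha> \<beta> :: complex
  defines "S \<equiv> (\<lambda>n. Phi n \<alpha> \<beta> a b q / qpoch q q n *
      (\<Sum>j\<le>n. qbinom n j q * (qpochs [c * v, d * v] q j / qpoch (c * d * u * v) q j)
                * u ^ j * v ^ (n - j)))"
  assumes "norm q < 1"
    and "u \<noteq> 0" and "v \<noteq> 0"
    and "\<And>z x n k. z \<in> {a, b, c, d} \<Longrightarrow> x \<in> {u, v} \<Longrightarrow> 1 - z * (x * q ^ n) * q ^ k \<noteq> 0"
    and "\<And>k. 1 - c * d * u * v * q ^ k \<noteq> 0"
  shows "((\<forall>z\<in>{a, b}. \<forall>x\<in>{u, v}. norm (z * x) < 1) \<longrightarrow> summable S) \<and>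
    (summable S \<longrightarrow>
      jackson_integral q u v
        (\<lambda>x. qpochs_inf [q * x / u, q * x / v, \<alpha> * a * x, \<beta> * b * x] q
              / qpochs_inf [a * x, b * x, c * x, d * x] q)
      = (1 - q) * v * qpochs_inf [q, u / v, q * v / u, c * d * u * v] q
          / qpochs_inf [c * u, c * v, d * u, d * v] q * (\<Sum>n. S n))"
proof -
  note q = assms(2) and uv = assms(3,4)
  have S_eq: "S = (\<lambda>n. Phi n \<alpha> \<beta> a b q / qpoch q q n * qbeta_moment_ratio q u v c d n)"
    by (simp add: S_def qbeta_moment_ratio_def)
  have ne: "qpoch_inf (z * x) q \<noteq> 0" if "z \<in> {a, b, c, d}" "x \<in> {u, v}" for z x
    using assms(5)[OF that, of 0] by (simp add: qpoch_inf_eq_0_iff[OF q])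
  have cd: "qpoch_inf (c * u) q \<noteq> 0" "qpoch_inf (c * v) q \<noteq> 0"
    "qpoch_inf (d * u) q \<noteq> 0" "qpoch_inf (d * v) q \<noteq> 0" 
    and ab: "qpoch_inf (a * u) q \<noteq> 0" "qpoch_inf (a * v) q \<noteq> 0"
    "qpoch_inf (b * u) q \<noteq> 0" "qpoch_inf (b * v) q \<noteq> 0"
    by (simp_all add: ne)
  have cduv: "qpoch_inf (c * d * u * v) q \<noteq> 0"
    using assms(6) by (simp add: qpoch_inf_eq_0_iff[OF q])
  have integrand: "qpochs_inf [q * x / u, q * x / v, \<alpha> * a * x, \<beta> * b * x] q
        / qpochs_inf [a * x, b * x, c * x, d * x] q
      = Phi_quotient q \<alpha> \<beta> a b x * qbeta_weight q u v c d x" for x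
    by (simp add: Phi_quotient_def qbeta_weight_def qpochs_inf_def mult_ac)
  have "summable S" if "\<forall>z\<in>{a, b}. \<forall>x\<in>{u, v}. norm (z * x) < 1"
    unfolding S_eq using that cduv by (intro summable_Phi_moment[OF q]) auto
  moreover have "jackson_integral q u v
        (\<lambda>x. qpochs_inf [q * x / u, q * x / v, \<alpha> * a * x, \<beta> * b * x] q
              / qpochs_inf [a * x, b * x, c * x, d * x] q)
      = (1 - q) * v * qpochs_inf [q, u / v, q * v / u, c * d * u * v] q
          / qpochs_inf [c * u, c * v, d * u, d * v] q * (\<Sum>n. S n)" if "summable S"
    unfolding integrand andrews_askey_integral[OF q uv cd, symmetric]
    using integral_Phi_quotient_eq_series[OF q uv cd cduv ab] that unfolding S_eq by blast
  ultimately show ?thesis by blast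
qed

end
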